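(* Let $\rho_0,\rho_1$ be faithful density operators on $\mathbb C^d$, let $a,b>0$ with $a+b=1$, and let $\mathcal E=\{(a,\rho_0),(b,\rho_1)\}$. On the manifold of rank-one PVMs $P=(|j\rangle\langle j|)_{j=1}^d$: (1) every local maximum of the mutual information $I_{\mathcal E}$ is globally optimal over all POVMs; (2) every second-order stationary PVM of $I_{\mathcal E}$ is globally optimal over all POVMs; (3) for every critical PVM of $I_{\mathcal E}$ which is not globally optimal there are $j\ne k$ with equal likelihood ratio $p_j/q_j=p_k/q_k=:t_\alpha$ (i.e. in a common degenerate posterior block) and a two-level rotation $P(\theta)$ of $|j\rangle,|k\rangle$ such that $$\frac{d^2}{d\theta^2}I_{\mathcal E}(P(\theta))\Big|_{\theta=0}=8|a_{jk}|^2\left(\frac1{q_j}+\frac1{q_k}\right)\mathcal K_{a,b}(t_\alpha)>0,$$ where $a_{jk}=\langle j|(\rho_0-t_\alpha\rho_1)|k\rangle$ and $$\mathcal K_{a,b}(t)=\int_0^1\frac{w_{a,b}(\lambda)\,d\lambda}{((1-\lambda)t+\lambda)^3},\qquad w_{a,b}(\lambda)=\begin{cases}a\lambda,&0\le\lambda\le b,\\ b(1-\lambda),&b\le\lambda\le1.\end{cases}$$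
   Context: Faithful means positive definite. A rank-one PVM is $P=(P_j)$, $P_j=|j\rangle\langle j|$ for an orthonormal basis of $\mathbb C^d$; ordered rank-one PVMs form the flag manifold $U(d)/U(1)^d$. For a finite POVM $M=(M_y)$ put $p_y=\mathrm{Tr}(\rho_0M_y)$, $q_y=\mathrm{Tr}(\rho_1M_y)$, $m_y=ap_y+bq_y$, and $$I_{\mathcal E}(M)=\sum_y\left[ap_y\log\frac{p_y}{m_y}+bq_y\log\frac{q_y}{m_y}\right]$$ (natural logarithm). A PVM is globally optimal over all POVMs if it attains $\sup_MI_{\mathcal E}(M)$ over finite POVMs. Critical means all first derivatives along tangent directions vanish; second-order stationary means critical with negative semidefinite Riemannian Hessian. The posterior of outcome $j$ is $r_j=ap_j/(ap_j+bq_j)$; a posterior block is a set of outcomes with equal $r_j$, equivalently equal $p_j/q_j$. Two-level rotation of $|j\rangle,|k\rangle$ (with some phase $\phi$): $|j(\theta)\rangle=\cos\theta|j\rangle+e^{i\phi}\sin\theta|k\rangle$, $|k(\theta)\rangle=-e^{-i\phi}\sin\theta|j\rangle+\cos\theta|k\rangle$, other basis vectors fixed. *)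

theory Defs
  imports "HOL-Analysis.Analysis"
begin

section \<open>Operators on complex Euclidean space\<close>

text \<open>The space \<open>\<complex>\<^sup>d\<close> is \<open>complex ^ 'n\<close> with \<open>d = CARD('n)\<close>. The library's \<open>inner\<close> on this type is the
  real inner product, so the Hermitian one is introduced here; it is antilinear in the first
  argument, as in bra-ket notation.\<close>

type_synonym 'n op = "complex ^ 'n ^ 'n"

definition hinner :: "complex ^ 'n::finite \<Rightarrow> complex ^ 'n \<Rightarrow> complex" where
  "hinner u v = (\<Sum>i\<in>UNIV. cnj (u $ i) * v $ i)"

definition ketbra :: "complex ^ 'n::finite \<Rightarrow> complex ^ 'n \<Rightarrow> 'n op" where
  "ketbra u v = (\<chi> i j. u $ i * cnj (v $ j))"

definition dagger :: "'n::finite op \<Rightarrow> 'n op" where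
  "dagger A = (\<chi> i j. cnj (A $ j $ i))"

definition hermitian :: "'n::finite op \<Rightarrow> bool" where
  "hermitian A \<longleftrightarrow> dagger A = A"

definition pos_semidef :: "'n::finite op \<Rightarrow> bool" where
  "pos_semidef A \<longleftrightarrow> hermitian A \<and> (\<forall>v. 0 \<le> Re (hinner v (A *v v)))"

definition pos_def :: "'n::finite op \<Rightarrow> bool" where
  "pos_def A \<longleftrightarrow> hermitian A \<and> (\<forall>v. v \<noteq> 0 \<longrightarrow> 0 < Re (hinner v (A *v v)))"

definition density_operator :: "'n::finite op \<Rightarrow> bool" where
  "density_operator \<rho> \<longleftrightarrow> pos_semidef \<rho> \<and> trace \<rho> = 1"

definition faithful :: "'n::finite op \<Rightarrow> bool" where
  "faithful \<rho> \<longleftrightarrow> pos_def \<rho>"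

definition mat_exp :: "'n::finite op \<Rightarrow> 'n op" where
  "mat_exp X = (\<Sum>k. (1 / fact k) *\<^sub>R (((**) X ^^ k) (mat 1)))"


section \<open>Measurements and mutual information\<close>

definition finite_povm :: "'y set \<Rightarrow> ('y \<Rightarrow> 'n::finite op) \<Rightarrow> bool" where
  "finite_povm Y M \<longleftrightarrow>
     finite Y \<and> (\<forall>y\<in>Y. pos_semidef (M y)) \<and> (\<Sum>y\<in>Y. M y) = mat 1"

text \<open>The trace of a product of two Hermitian matrices is real, so \<open>Re\<close> discards nothing.\<close>

definition born :: "'n::finite op \<Rightarrow> 'n op \<Rightarrow> real" where
  "born \<rho> E = Re (trace (\<rho> ** E))"

text \<open>Terms with \<open>p = 0\<close> or \<open>q = 0\<close> follow the usual convention \<open>0 log 0 = 0\<close>.\<close>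

definition mutual_info ::
    "real \<Rightarrow> real \<Rightarrow> 'n::finite op \<Rightarrow> 'n op \<Rightarrow> 'y set \<Rightarrow> ('y \<Rightarrow> 'n op) \<Rightarrow> real" where
  "mutual_info a b \<rho>\<^sub>0 \<rho>\<^sub>1 Y M =
     (\<Sum>y\<in>Y. let p = born \<rho>\<^sub>0 (M y); q = born \<rho>\<^sub>1 (M y); m = a * p + b * q
             in a * p * ln (p / m) + b * q * ln (q / m))"

definition posterior :: "real \<Rightarrow> real \<Rightarrow> 'n::finite op \<Rightarrow> 'n op \<Rightarrow> 'n op \<Rightarrow> real" where
  "posterior a b \<rho>\<^sub>0 \<rho>\<^sub>1 E = a * born \<rho>\<^sub>0 E / (a * born \<rho>\<^sub>0 E + b * born \<rho>\<^sub>1 E)"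


section \<open>Rank-one PVMs\<close>

text \<open>An orthonormal family indexed by \<open>'n\<close> has \<open>d\<close> members, so it is a basis.\<close>

definition orthonormal_basis :: "('n::finite \<Rightarrow> complex ^ 'n) \<Rightarrow> bool" where
  "orthonormal_basis e \<longleftrightarrow> (\<forall>j k. hinner (e j) (e k) = (if j = k then 1 else 0))"

definition pvm_of :: "('n::finite \<Rightarrow> complex ^ 'n) \<Rightarrow> 'n \<Rightarrow> 'n op" where
  "pvm_of e = (\<lambda>j. ketbra (e j) (e j))"

definition rank_one_pvms :: "('n::finite \<Rightarrow> 'n op) set" where
  "rank_one_pvms = {pvm_of e | e. orthonormal_basis e}"

abbreviation pvm_info ::
    "real \<Rightarrow> real \<Rightarrow> 'n::finite op \<Rightarrow> 'n op \<Rightarrow> ('n \<Rightarrow> 'n op) \<Rightarrow> real" where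
  "pvm_info a b \<rho>\<^sub>0 \<rho>\<^sub>1 \<equiv> mutual_info a b \<rho>\<^sub>0 \<rho>\<^sub>1 UNIV"

text \<open>Every finite outcome set can be relabelled by natural numbers. The supremum is taken in the
  extended reals, so that it exists without a boundedness argument.\<close>

definition globally_optimal ::
    "real \<Rightarrow> real \<Rightarrow> 'n::finite op \<Rightarrow> 'n op \<Rightarrow> ('n \<Rightarrow> 'n op) \<Rightarrow> bool" where
  "globally_optimal a b \<rho>\<^sub>0 \<rho>\<^sub>1 P \<longleftrightarrow>
     ereal (pvm_info a b \<rho>\<^sub>0 \<rho>\<^sub>1 P) =
       (SUP (Y, M) \<in> {(Y :: nat set, M). finite_povm Y M}. ereal (mutual_info a b \<rho>\<^sub>0 \<rho>\<^sub>1 Y M))"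


section \<open>The flag manifold\<close>

text \<open>The manifold \<open>rank_one_pvms\<close>, which is \<open>U(d)/U(1)\<^sup>d\<close>, carries the subspace topology of the
  product of matrix spaces.\<close>

definition local_maximum :: "(('n::finite \<Rightarrow> 'n op) \<Rightarrow> real) \<Rightarrow> ('n \<Rightarrow> 'n op) \<Rightarrow> bool" where
  "local_maximum f P \<longleftrightarrow>
     P \<in> rank_one_pvms \<and> (\<forall>\<^sub>F Q in at P within rank_one_pvms. f Q \<le> f P)"

text \<open>The tangent space at \<open>P\<close> consists of the families \<open>([X, P\<^sub>j])\<^sub>j\<close> with \<open>X\<close> skew-Hermitian, and
  each is given by a unique \<open>X\<close> with vanishing diagonal in the basis of \<open>P\<close>; tangent vectors are
  represented by these \<open>X\<close>.\<close>

definition tangent :: "('n::finite \<Rightarrow> 'n op) \<Rightarrow> 'n op set" where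
  "tangent P = {X. dagger X = - X \<and> (\<forall>j. P j ** X ** P j = 0)}"

text \<open>The metric is \<open>\<langle>V, W\<rangle> = \<Sum>\<^sub>j Tr (V\<^sub>j W\<^sub>j)\<close>, induced from the product of matrix spaces. For
  \<open>V\<^sub>j = [X, P\<^sub>j]\<close> it gives \<open>\<langle>V, V\<rangle> = 2 Tr (X\<^sup>\<dagger> X)\<close>, so it is the normal homogeneous metric of
  \<open>U(d)/U(1)\<^sup>d\<close>, and its geodesics are the orbits below.\<close>

definition geodesic :: "('n::finite \<Rightarrow> 'n op) \<Rightarrow> 'n op \<Rightarrow> real \<Rightarrow> 'n \<Rightarrow> 'n op" where
  "geodesic P X t = (\<lambda>j. mat_exp (t *\<^sub>R X) ** P j ** mat_exp (- t *\<^sub>R X))"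

definition has_second_deriv :: "(real \<Rightarrow> real) \<Rightarrow> real \<Rightarrow> real \<Rightarrow> bool" where
  "has_second_deriv f D x \<longleftrightarrow>
     (\<exists>f'. (\<forall>\<^sub>F y in nhds x. (f has_real_derivative f' y) (at y)) \<and>
           (f' has_real_derivative D) (at x))"

definition critical :: "(('n::finite \<Rightarrow> 'n op) \<Rightarrow> real) \<Rightarrow> ('n \<Rightarrow> 'n op) \<Rightarrow> bool" where
  "critical f P \<longleftrightarrow>
     P \<in> rank_one_pvms \<and>
     (\<forall>X\<in>tangent P. ((\<lambda>t. f (geodesic P X t)) has_real_derivative 0) (at 0))"

text \<open>The Riemannian Hessian as a quadratic form: \<open>Hess f (V, V)\<close> is the second derivative of \<open>f\<close>
  along the geodesic with initial velocity \<open>V\<close>.\<close>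

definition has_hessian ::
    "(('n::finite \<Rightarrow> 'n op) \<Rightarrow> real) \<Rightarrow> ('n \<Rightarrow> 'n op) \<Rightarrow> 'n op \<Rightarrow> real \<Rightarrow> bool" where
  "has_hessian f P X D \<longleftrightarrow> has_second_deriv (\<lambda>t. f (geodesic P X t)) D 0"

definition second_order_stationary ::
    "(('n::finite \<Rightarrow> 'n op) \<Rightarrow> real) \<Rightarrow> ('n \<Rightarrow> 'n op) \<Rightarrow> bool" where
  "second_order_stationary f P \<longleftrightarrow>
     critical f P \<and> (\<forall>X\<in>tangent P. \<exists>D\<le>0. has_hessian f P X D)"

definition two_level_rotation ::
    "('n::finite \<Rightarrow> complex ^ 'n) \<Rightarrow> 'n \<Rightarrow> 'n \<Rightarrow> real \<Rightarrow> real \<Rightarrow> 'n \<Rightarrow> complex ^ 'n" where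
  "two_level_rotation e j k \<phi> \<theta> = e(
     j := complex_of_real (cos \<theta>) *s e j + (cis \<phi> * complex_of_real (sin \<theta>)) *s e k,
     k := - (cis (- \<phi>) * complex_of_real (sin \<theta>)) *s e j + complex_of_real (cos \<theta>) *s e k)"


section \<open>The curvature kernel\<close>

definition w_kernel :: "real \<Rightarrow> real \<Rightarrow> real \<Rightarrow> real" where
  "w_kernel a b s = (if s \<le> b then a * s else b * (1 - s))"

definition K_kernel :: "real \<Rightarrow> real \<Rightarrow> real \<Rightarrow> real" where
  "K_kernel a b t = integral {0..1} (\<lambda>s. w_kernel a b s / ((1 - s) * t + s) ^ 3)"

end

theory Submission
  imports Defs
begin

text \<open>
  Put \<open>m\<^sub>j = a p\<^sub>j + b q\<^sub>j\<close>, \<open>x\<^sub>j = p\<^sub>j / m\<^sub>j\<close> and \<open>y\<^sub>j = q\<^sub>j / m\<^sub>j\<close>. The mutual information of a PVM is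
  the value at \<open>X = \<Sum>\<^sub>j x\<^sub>j P\<^sub>j\<close>, \<open>Y = \<Sum>\<^sub>j y\<^sub>j P\<^sub>j\<close> of \<open>a Tr (\<rho>\<^sub>0 ln X) + b Tr (\<rho>\<^sub>1 ln Y)\<close>. On the set
  \<open>a X + b Y = 1\<close> this functional is concave, because \<open>ln\<close> is operator concave, and by the operator
  Jensen inequality its supremum bounds the mutual information of every POVM. Its gradient
  vanishes iff \<open>L(x\<^sub>j, x\<^sub>k) \<langle>j|\<rho>\<^sub>0|k\<rangle> = L(y\<^sub>j, y\<^sub>k) \<langle>j|\<rho>\<^sub>1|k\<rangle>\<close> for all \<open>j\<close>, \<open>k\<close>, where \<open>L\<close> is the
  divided difference of \<open>ln\<close>. For \<open>x\<^sub>j \<noteq> x\<^sub>k\<close> this is criticality of the PVM under rotations of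
  \<open>|j\<rangle>\<close> and \<open>|k\<rangle>\<close>; inside a posterior block it says \<open>a\<^sub>j\<^sub>k = 0\<close>. So a critical PVM is optimal unless
  some \<open>a\<^sub>j\<^sub>k\<close> in a block is nonzero, and then the rotation of \<open>|j\<rangle>\<close> and \<open>|k\<rangle>\<close> whose phase makes
  \<open>e\<^sup>i\<^sup>\<phi> a\<^sub>j\<^sub>k\<close> positive has a positive second derivative.
\<close>

section \<open>Hermitian forms and rank-one operators\<close>

lemma hinner_add_right: "hinner u (v + w) = hinner u v + hinner u w"
  by (simp add: hinner_def algebra_simps sum.distrib)

lemma hinner_diff_right: "hinner u (v - w) = hinner u v - hinner u w"
  by (simp add: hinner_def algebra_simps sum_subtractf)

lemma hinner_add_left: "hinner (u + v) w = hinner u w + hinner v w"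
  by (simp add: hinner_def algebra_simps sum.distrib)

lemma hinner_diff_left: "hinner (u - v) w = hinner u w - hinner v w"
  by (simp add: hinner_def algebra_simps sum_subtractf)

lemma hinner_scale_right: "hinner u (c *s v) = c * hinner u v"
  by (simp add: hinner_def sum_distrib_left algebra_simps)

lemma hinner_scale_left: "hinner (c *s u) v = cnj c * hinner u v"
  by (simp add: hinner_def sum_distrib_left algebra_simps)

lemma hinner_zero [simp]: "hinner 0 u = 0" "hinner u 0 = 0"
  by (simp_all add: hinner_def)

lemma cnj_hinner: "cnj (hinner u v) = hinner v u"
  by (simp add: hinner_def mult.commute)

lemma hinner_dagger: "hinner u (A *v v) = hinner (dagger A *v u) v"
  unfolding hinner_def matrix_vector_mult_def dagger_def
  by (simp add: sum_distrib_left sum_distrib_right) (subst sum.swap, simp add: mult_ac)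

lemma hinner_hermitian: "hermitian A \<Longrightarrow> hinner u (A *v v) = cnj (hinner v (A *v u))"
  by (metis cnj_hinner hermitian_def hinner_dagger)

lemma hinner_axis_left: "hinner (axis i 1) v = v $ i"
proof -
  have "hinner (axis i 1) v = (\<Sum>k\<in>UNIV. if k = i then v $ k else 0)"
    unfolding hinner_def by (intro sum.cong) (auto simp: axis_def)
  then show ?thesis by simp
qed

lemma mult_axis_nth: "(A *v axis i 1) $ j = A $ j $ i" for A :: "'n::finite op"
proof -
  have "(A *v axis i 1) $ j = (\<Sum>k\<in>UNIV. if k = i then A $ j $ k else 0)"
    unfolding matrix_vector_mult_def axis_def vec_lambda_beta by (intro sum.cong) auto
  then show ?thesis by simp
qed

lemma ketbra_mult_vec: "ketbra u v *v w = hinner v w *s u"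
  by (simp add: ketbra_def matrix_vector_mult_def hinner_def vec_eq_iff
      sum_distrib_left mult_ac)

lemma mult_ketbra: "A ** ketbra u v = ketbra (A *v u) v"
  by (simp add: ketbra_def matrix_matrix_mult_def matrix_vector_mult_def vec_eq_iff
      sum_distrib_left mult_ac)

lemma ketbra_mult: "ketbra u v ** A = ketbra u (dagger A *v v)"
  by (simp add: ketbra_def matrix_matrix_mult_def matrix_vector_mult_def dagger_def vec_eq_iff
      sum_distrib_left mult_ac)

lemma dagger_ketbra: "dagger (ketbra u v) = ketbra v u"
  by (simp add: dagger_def ketbra_def vec_eq_iff mult.commute)

lemma trace_ketbra: "trace (ketbra u v) = hinner v u"
  by (simp add: trace_def ketbra_def hinner_def mult.commute)

lemma dagger_add: "dagger (A + B) = dagger A + dagger B"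
  by (simp add: dagger_def vec_eq_iff)

lemma dagger_diff: "dagger (A - B) = dagger A - dagger B"
  by (simp add: dagger_def vec_eq_iff)

lemma dagger_scaleR: "dagger (c *\<^sub>R A) = c *\<^sub>R dagger A"
  by (simp add: dagger_def vec_eq_iff)

lemma dagger_mult: "dagger (A ** B) = dagger B ** dagger A"
  by (simp add: dagger_def matrix_matrix_mult_def vec_eq_iff mult.commute)

lemma dagger_mat1 [simp]: "dagger (mat 1) = mat 1"
  by (auto simp: dagger_def mat_def vec_eq_iff)

lemma dagger_sum: "dagger (\<Sum>i\<in>S. f i) = (\<Sum>i\<in>S. dagger (f i))"
  by (simp add: dagger_def vec_eq_iff)

section \<open>Linearity of the Born weights in each argument\<close>

lemma born_add_left: "born (A + B) E = born A E + born B E"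
  by (simp add: born_def matrix_matrix_mult_def trace_def algebra_simps sum.distrib)

lemma born_scaleR_left: "born (c *\<^sub>R A) E = c * born A E"
  by (simp add: born_def matrix_matrix_mult_def trace_def sum_distrib_left
      scaleR_sum_right mult.assoc)

lemma born_zero [simp]: "born 0 E = 0" "born A 0 = 0"
  by (simp_all add: born_def trace_def matrix_matrix_mult_def)

lemma born_add_right: "born A (E + F) = born A E + born A F"
  by (simp add: born_def matrix_add_ldistrib trace_add)

lemma born_sum_left: "born (\<Sum>i\<in>S. f i) E = (\<Sum>i\<in>S. born (f i) E)"
  by (induction S rule: infinite_finite_induct) (auto simp: born_add_left)

lemma born_sum_right: "born A (\<Sum>i\<in>S. f i) = (\<Sum>i\<in>S. born A (f i))"
  by (induction S rule: infinite_finite_induct) (auto simp: born_add_right)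

lemma born_ketbra: "born A (ketbra u v) = Re (hinner v (A *v u))"
  by (simp add: born_def mult_ketbra trace_ketbra)

section \<open>Positive semidefinite matrices as sums of rank-one operators\<close>

lemma hermitian_quadratic_diff:
  assumes "hermitian M"
  shows "Re (hinner (v - c *s x) (M *v (v - c *s x))) =
    Re (hinner v (M *v v)) - 2 * Re (cnj c * hinner x (M *v v)) + (cmod c)\<^sup>2 * Re (hinner x (M *v x))"
proof -
  have "hinner v (M *v x) = cnj (hinner x (M *v v))"
    using hinner_hermitian[OF assms] .
  then show ?thesis
    unfolding cmod_power2
    by (simp add: power2_eq_square matrix_vector_mult_diff_distrib vector_scalar_commute
      hinner_diff_left
      hinner_diff_right hinner_scale_left hinner_scale_right algebra_simps)
qed

text \<open>The form is nonnegative at \<open>v - c *s x\<close>. Taking \<open>c\<close> to be a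
  real multiple \<open>s\<close> of \<open>hinner x (M *v v)\<close> gives a quadratic in
  \<open>s\<close> that is nonnegative for all \<open>s\<close>.\<close>

lemma pos_semidef_Cauchy_Schwarz:
  assumes "pos_semidef M"
  shows "(cmod (hinner x (M *v v)))\<^sup>2 \<le> Re (hinner x (M *v x)) * Re (hinner v (M *v v))"
proof -
  let ?c = "hinner x (M *v v)"
  let ?m = "Re (hinner x (M *v x))" and ?n = "Re (hinner v (M *v v))"
  have *: "0 \<le> ?n - 2 * s * (cmod ?c)\<^sup>2 + s\<^sup>2 * (cmod ?c)\<^sup>2 * ?m" for s
  proof -
    have "cnj (of_real s * ?c) * ?c = of_real (s * (cmod ?c)\<^sup>2)"
      by (metis complex_cnj_complex_of_real complex_cnj_mult complex_norm_square mult.assoc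
          mult.commute of_real_mult)
    then have "0 \<le> ?n - 2 * (s * (cmod ?c)\<^sup>2) + (cmod (of_real s * ?c))\<^sup>2 * ?m"
      using assms hermitian_quadratic_diff[of M v "of_real s * ?c" x]
      unfolding pos_semidef_def by (metis Re_complex_of_real)
    then show ?thesis
      by (simp add: norm_mult power_mult_distrib)
  qed
  have "0 \<le> ?m" "0 \<le> ?n" using assms by (auto simp: pos_semidef_def)
  show ?thesis
  proof (cases "?m = 0")
    case True
    have "(cmod ?c)\<^sup>2 = 0"
    proof (rule ccontr)
      assume "(cmod ?c)\<^sup>2 \<noteq> 0"
      \<comment> \<open>With the quadratic coefficient gone the bound is affine in \<open>s\<close>,
        and this \<open>s\<close> makes it equal to -1.\<close>
      then show False using *[of "(?n + 1) / (2 * (cmod ?c)\<^sup>2)"] True by simp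
    qed
    then show ?thesis using True by simp
  next
    case False
    \<comment> \<open>This \<open>s\<close> minimises the quadratic.\<close>
    then show ?thesis using *[of "1 / ?m"] \<open>0 \<le> ?m\<close>
      by (simp add: field_simps power2_eq_square)
  qed
qed

text \<open>Cholesky elimination: \<open>S\<close> contains the indices of the rows that may still
  be nonzero, and each induction step clears the row of one pivot \<open>i\<close> by subtracting a
  rank-one operator.\<close>

lemma pos_semidef_ketbra_sum_on:
  fixes M :: "'n::finite op"
  assumes "finite S" "pos_semidef M" "\<And>i j. i \<notin> S \<Longrightarrow> M $ i $ j = 0"
  shows "\<exists>w. M = (\<Sum>i\<in>S. ketbra (w i) (w i))"
  using assms
proof (induction S arbitrary: M rule: finite_induct)
  case empty
  then show ?case by (simp add: vec_eq_iff)
next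
  case (insert i S)
  define m where "m = Re (M $ i $ i)"
  have herm: "hermitian M" using insert.prems by (simp add: pos_semidef_def)
  have entry: "hinner (axis k 1) (M *v v) = (M *v v) $ k" for k v
    by (rule hinner_axis_left)
  have diag: "M $ i $ i = of_real m"
    using hinner_hermitian[OF herm, of "axis i 1" "axis i 1"]
    by (simp add: entry mult_axis_nth m_def complex_eq_iff)
  have CS: "(cmod ((M *v v) $ i))\<^sup>2 \<le> m * Re (hinner v (M *v v))" for v
    using pos_semidef_Cauchy_Schwarz[OF insert.prems(1), of "axis i 1" v]
    by (simp add: entry mult_axis_nth m_def)
  have sym: "M $ k $ l = cnj (M $ l $ k)" for k l
    using herm unfolding hermitian_def dagger_def by (metis vec_lambda_beta)
  have "0 \<le> m" using insert.prems(1) entry[of i "axis i 1"]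
    by (metis pos_semidef_def mult_axis_nth m_def)
  show ?case
  proof (cases "m = 0")
    case True
    \<comment> \<open>By Cauchy-Schwarz a vanishing pivot forces its whole row to vanish.\<close>
    have "M $ i $ j = 0" for j
      using CS[of "axis j 1"] True by (simp add: mult_axis_nth)
    then have "\<And>k j. k \<notin> S \<Longrightarrow> M $ k $ j = 0"
      using insert.prems(2) by (metis insertE)
    then obtain w where w: "M = (\<Sum>i\<in>S. ketbra (w i) (w i))"
      using insert.IH insert.prems(1) by blast
    have "M = (\<Sum>k\<in>insert i S. ketbra ((w(i := 0)) k) ((w(i := 0)) k))"
      using insert.hyps unfolding w
      by (simp add: ketbra_def vec_eq_iff) (intro allI sum.cong, auto)
    then show ?thesis by blast
  next
    case False
    with \<open>0 \<le> m\<close> have m: "m > 0" by simp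
    \<comment> \<open>The pivot column, scaled so that \<open>ketbra x x\<close> agrees with
      \<open>M\<close> in row \<open>i\<close>. Then \<open>M'\<close> is the Schur complement, and
      Cauchy-Schwarz with \<open>axis i 1\<close> is exactly its positivity.\<close>
    define x where "x = of_real (1 / sqrt m) *s (M *v axis i 1)"
    define M' where "M' = M - ketbra x x"
    have x_nth: "x $ k = M $ k $ i / of_real (sqrt m)" for k
      by (simp add: x_def mult_axis_nth divide_inverse mult.commute)
    have sq: "of_real (sqrt m) * of_real (sqrt m) = (of_real m :: complex)"
      using m by (simp flip: of_real_mult)
    have "hermitian M'"
      using herm by (simp add: hermitian_def M'_def dagger_diff dagger_ketbra)
    moreover have "0 \<le> Re (hinner v (M' *v v))" for v
    proof -
      have "hinner (M *v axis i 1) v = (M *v v) $ i"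
        using hinner_dagger[of "axis i 1" M v] herm by (simp add: entry hermitian_def)
      then have "hinner x v = of_real (1 / sqrt m) * (M *v v) $ i"
        by (simp add: x_def hinner_scale_left)
      then have "(cmod (hinner x v))\<^sup>2 = (cmod ((M *v v) $ i))\<^sup>2 / m"
        using m by (simp add: norm_mult norm_divide power_divide)
      then have "(cmod (hinner x v))\<^sup>2 \<le> Re (hinner v (M *v v))"
        using CS[of v] m by (simp add: pos_divide_le_eq mult.commute)
      moreover have "hinner v (M' *v v) = hinner v (M *v v) - of_real ((cmod (hinner x v))\<^sup>2)"
        by (simp add: M'_def matrix_vector_mult_diff_rdistrib hinner_diff_right ketbra_mult_vec
            hinner_scale_right complex_norm_square cnj_hinner del: of_real_power)
      ultimately show ?thesis by simp
    qed
    ultimately have "pos_semidef M'" by (simp add: pos_semidef_def)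
    moreover have "M' $ k $ j = 0" if "k \<notin> S" for k j
    proof (cases "k = i")
      case True
      then show ?thesis using m sq sym[of i j]
        by (simp add: M'_def ketbra_def x_nth diag)
    next
      case False
      then show ?thesis using insert.prems(2)[of k] that
        by (simp add: M'_def ketbra_def x_nth)
    qed
    ultimately obtain w where w: "M' = (\<Sum>i\<in>S. ketbra (w i) (w i))"
      using insert.IH by blast
    have "M = ketbra x x + M'" by (simp add: M'_def)
    also have "\<dots> = (\<Sum>k\<in>insert i S. ketbra ((w(i := x)) k) ((w(i := x)) k))"
      using insert.hyps unfolding w by (simp, intro sum.cong) auto
    finally show ?thesis by blast
  qed
qed

lemma pos_semidef_ketbra_sum:
  fixes M :: "'n::finite op"
  assumes "pos_semidef M"
  obtains w :: "'n \<Rightarrow> complex ^ 'n" where "M = (\<Sum>i\<in>UNIV. ketbra (w i) (w i))"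
  using pos_semidef_ketbra_sum_on[of UNIV M, OF finite assms] that by blast

text \<open>Splitting \<open>M\<close> into rank-one pieces turns the trace into a sum of values of
  the quadratic form of \<open>A\<close>.\<close>

lemma born_nonneg:
  fixes A M :: "'n::finite op"
  assumes "pos_semidef A" "pos_semidef M"
  shows "0 \<le> born A M"
proof -
  obtain w :: "'n \<Rightarrow> complex ^ 'n" where "M = (\<Sum>i\<in>UNIV. ketbra (w i) (w i))"
    using pos_semidef_ketbra_sum[OF assms(2)] .
  then show ?thesis using assms(1)
    by (auto simp: born_sum_right born_ketbra pos_semidef_def intro!: sum_nonneg)
qed

lemma born_pos:
  fixes A M :: "'n::finite op"
  assumes "pos_def A" "pos_semidef M" "M \<noteq> 0"
  shows "0 < born A M"
proof -
  obtain w :: "'n \<Rightarrow> complex ^ 'n" where w: "M = (\<Sum>i\<in>UNIV. ketbra (w i) (w i))"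
    using pos_semidef_ketbra_sum[OF assms(2)] .
  have "\<exists>i. w i \<noteq> 0"
  proof (rule ccontr)
    assume "\<not> ?thesis"
    then have "M = 0" unfolding w by (simp add: ketbra_def vec_eq_iff)
    with assms show False by simp
  qed
  then obtain i where i: "w i \<noteq> 0" ..
  have "0 \<le> Re (hinner v (A *v v))" for v
    using assms(1) unfolding pos_def_def by (cases "v = 0") (auto intro: less_imp_le)
  moreover have "0 < Re (hinner (w i) (A *v w i))"
    using assms(1) i by (auto simp: pos_def_def)
  ultimately show ?thesis
    unfolding w born_sum_right born_ketbra by (intro sum_pos2[of UNIV i]) auto
qed

section \<open>The integral kernel of the logarithm\<close>

text \<open>On the diagonal this is the limit of the quotient. These are the entries of the Loewner
  matrix of \<open>ln\<close>, which multiplies a perturbation entrywise to give the derivative of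
  the operator logarithm at a diagonal operator.\<close>

definition ln_div_diff :: "real \<Rightarrow> real \<Rightarrow> real" where
  "ln_div_diff x y = (if x = y then 1 / x else (ln x - ln y) / (x - y))"

lemma affine_pos:
  fixes x s :: real
  assumes "0 < x" "0 \<le> s" "s \<le> 1"
  shows "0 < 1 + s * (x - 1)"
proof -
  have "1 + s * (x - 1) = (1 - s) + s * x" by (simp add: algebra_simps)
  also have "\<dots> > 0" using assms
    by (cases "s = 1") (auto intro!: add_pos_nonneg)
  finally show ?thesis .
qed

lemma ln_has_integral:
  fixes x :: real
  assumes "0 < x"
  shows "((\<lambda>s. (x - 1) / (1 + s * (x - 1))) has_integral ln x) {0..1}"
proof -
  have "((\<lambda>s. (x - 1) / (1 + s * (x - 1))) has_integral
      ln (1 + 1 * (x - 1)) - ln (1 + 0 * (x - 1))) {0..1}"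
    by (intro fundamental_theorem_of_calculus)
      (auto simp flip: has_real_derivative_iff_has_vector_derivative intro!: derivative_eq_intros
        affine_pos[OF assms])
  then show ?thesis by simp
qed

text \<open>The integrand is the difference quotient in \<open>x\<close> and \<open>y\<close> of the
  one in \<open>ln_has_integral\<close>. For each \<open>s\<close> it is a product of a function of
  \<open>x\<close> and the same function of \<open>y\<close>, which is what later yields
  positivity.\<close>

lemma ln_div_diff_has_integral:
  fixes x y :: real
  assumes "0 < x" "0 < y"
  shows "((\<lambda>s. 1 / ((1 + s * (x - 1)) * (1 + s * (y - 1)))) has_integral ln_div_diff x y) {0..1}"
proof (cases "x = y")
  case True
  have D: "((\<lambda>s. s / (1 + s * (x - 1))) has_real_derivative
      1 / ((1 + s * (x - 1)) * (1 + s * (x - 1)))) (at s within {0..1})" if "s \<in> {0..1}" for s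
  proof -
    have "0 < 1 + s * (x - 1)" using affine_pos[OF assms(1)] that by auto
    then show ?thesis
      by (auto intro!: derivative_eq_intros simp: algebra_simps)
  qed
  have "((\<lambda>s. 1 / ((1 + s * (x - 1)) * (1 + s * (x - 1)))) has_integral
      1 / (1 + 1 * (x - 1)) - 0 / (1 + 0 * (x - 1))) {0..1}"
    by (intro fundamental_theorem_of_calculus)
      (auto simp flip: has_real_derivative_iff_has_vector_derivative intro!: D)
  then show ?thesis using True by (simp add: ln_div_diff_def)
next
  case False
  have D: "((\<lambda>s. (ln (1 + s * (x - 1)) - ln (1 + s * (y - 1))) / (x - y)) has_real_derivative
      1 / ((1 + s * (x - 1)) * (1 + s * (y - 1)))) (at s within {0..1})"
    if "s \<in> {0..1}" for s
  proof -
    have X: "0 < 1 + s * (x - 1)" and Y: "0 < 1 + s * (y - 1)"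
      using affine_pos[OF assms(1)] affine_pos[OF assms(2)] that by auto
    have "((\<lambda>s. (ln (1 + s * (x - 1)) - ln (1 + s * (y - 1))) / (x - y)) has_real_derivative
      ((x - 1) / (1 + s * (x - 1)) - (y - 1) / (1 + s * (y - 1))) / (x - y)) (at s within {0..1})"
      using X Y False by (auto intro!: derivative_eq_intros)
    moreover have "((x - 1) / (1 + s * (x - 1)) - (y - 1) / (1 + s * (y - 1))) / (x - y) =
        1 / ((1 + s * (x - 1)) * (1 + s * (y - 1)))"
    proof -
      have "(x - 1) * (1 + s * (y - 1)) - (y - 1) * (1 + s * (x - 1)) = x - y"
        by (simp add: algebra_simps)
      with X Y False show ?thesis by (simp add: diff_frac_eq)
    qed
    ultimately show ?thesis by simp
  qed
  have "((\<lambda>s. 1 / ((1 + s * (x - 1)) * (1 + s * (y - 1)))) has_integral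
      (ln (1 + 1 * (x - 1)) - ln (1 + 1 * (y - 1))) / (x - y) -
      (ln (1 + 0 * (x - 1)) - ln (1 + 0 * (y - 1))) / (x - y)) {0..1}"
    by (intro fundamental_theorem_of_calculus)
      (auto simp flip: has_real_derivative_iff_has_vector_derivative intro!: D)
  then show ?thesis using False by (simp add: ln_div_diff_def)
qed

text \<open>The gap in the first-order form of operator concavity of \<open>ln\<close>: the derivative at \<open>diag x\<close> in the
  direction \<open>z M - (M X + X M) / 2\<close>, minus the corresponding combination of logarithms, has the
  entries \<open>ln_gap z (x j) (x k) * M $ j $ k\<close>. The integrand below is a rank-one kernel in \<open>(x, y)\<close>.\<close>

definition ln_gap :: "real \<Rightarrow> real \<Rightarrow> real \<Rightarrow> real" where
  "ln_gap z x y = ln_div_diff x y * (z - (x + y) / 2) - ln z + (ln x + ln y) / 2"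

lemma ln_gap_has_integral:
  assumes "0 < x" "0 < y" "0 < z"
  shows "((\<lambda>s. s / (1 + s * (z - 1)) * ((z - x) / (1 + s * (x - 1)) * ((z - y) / (1 + s * (y - 1)))))
    has_integral ln_gap z x y) {0..1}"
proof -
  have "((\<lambda>s. 1 / ((1 + s * (x - 1)) * (1 + s * (y - 1))) * (z - (x + y) / 2)
      - (z - 1) / (1 + s * (z - 1))
      + ((x - 1) / (1 + s * (x - 1)) + (y - 1) / (1 + s * (y - 1))) / 2)
    has_integral ln_gap z x y) {0..1}"
    unfolding ln_gap_def
    by (intro has_integral_add has_integral_diff has_integral_mult_left has_integral_divide
        ln_has_integral ln_div_diff_has_integral assms)
  moreover have "1 / ((1 + s * (x - 1)) * (1 + s * (y - 1))) * (z - (x + y) / 2)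
      - (z - 1) / (1 + s * (z - 1))
      + ((x - 1) / (1 + s * (x - 1)) + (y - 1) / (1 + s * (y - 1))) / 2 =
      s / (1 + s * (z - 1)) * ((z - x) / (1 + s * (x - 1)) * ((z - y) / (1 + s * (y - 1))))"
    if "s \<in> {0..1}" for s
  proof -
    define X Y Z where "X = 1 + s * (x - 1)" and "Y = 1 + s * (y - 1)" and "Z = 1 + s * (z - 1)"
    have "X > 0" "Y > 0" "Z > 0"
      using that affine_pos assms by (auto simp: X_def Y_def Z_def)
    \<comment> \<open>The numerators stay abstract while denominators are cleared; only afterwards
      are \<open>X\<close>, \<open>Y\<close>, \<open>Z\<close> expanded, and the numerator then
      factors as \<open>2 * s * (z - x) * (z - y)\<close>.\<close>
    then have "1 / (X * Y) * (n / 2) - p / Z + (q / X + r / Y) / 2 =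
        (n * Z - 2 * p * (X * Y) + (q * Y + r * X) * Z) / (2 * X * Y * Z)" for n p q r
      by (simp add: field_simps)
    from this[of "2 * z - (x + y)" "z - 1" "x - 1" "y - 1"]
    have "1 / (X * Y) * ((2 * z - (x + y)) / 2) - (z - 1) / Z + ((x - 1) / X + (y - 1) / Y) / 2 =
      ((2 * z - (x + y)) * Z - 2 * (z - 1) * (X * Y) + ((x - 1) * Y + (y - 1) * X) * Z)
        / (2 * X * Y * Z)" .
    also have "(2 * z - (x + y)) * Z - 2 * (z - 1) * (X * Y) + ((x - 1) * Y + (y - 1) * X) * Z
      = 2 * (s * ((z - x) * (z - y)))"
      unfolding X_def Y_def Z_def by (simp add: algebra_simps)
    also have "2 * (s * ((z - x) * (z - y))) / (2 * X * Y * Z) =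
        s / Z * ((z - x) / X * ((z - y) / Y))"
    proof -
      have "2 * (s * (p * q)) / (2 * X * Y * Z) = s / Z * (p / X * (q / Y))" for p q
        by (simp add: mult_ac)
      then show ?thesis .
    qed
    also have "(2 * z - (x + y)) / 2 = z - (x + y) / 2"
      by (simp add: diff_divide_distrib)
    finally show ?thesis
      unfolding X_def Y_def Z_def .
  qed
  ultimately show ?thesis
    by (rule has_integral_eq[rotated])
qed

text \<open>For each \<open>s\<close> the kernel is a nonnegative factor times
  \<open>c j * c k\<close>, so the sum is an instance of the hypothesis on \<open>B\<close>;
  integrating over \<open>s\<close> preserves the sign.\<close>

lemma ln_gap_form_nonneg:
  fixes B :: "'i \<Rightarrow> 'i \<Rightarrow> real"
  assumes B: "\<And>c. 0 \<le> (\<Sum>j\<in>S. \<Sum>k\<in>S. c j * c k * B j k)"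
    and "\<And>j. 0 < x j" "0 < z"
  shows "0 \<le> (\<Sum>j\<in>S. \<Sum>k\<in>S. ln_gap z (x j) (x k) * B j k)"
proof (cases "finite S")
  case True
  define c where "c s j = (z - x j) / (1 + s * (x j - 1))" for s j
  have "((\<lambda>s. \<Sum>j\<in>S. \<Sum>k\<in>S. s / (1 + s * (z - 1)) * (c s j * c s k) * B j k) has_integral
      (\<Sum>j\<in>S. \<Sum>k\<in>S. ln_gap z (x j) (x k) * B j k)) {0..1}"
    unfolding c_def using assms True
    by (intro has_integral_sum has_integral_mult_left ln_gap_has_integral) auto
  moreover have "0 \<le> (\<Sum>j\<in>S. \<Sum>k\<in>S. s / (1 + s * (z - 1)) * (c s j * c s k) * B j k)"
    if "s \<in> {0..1}" for s
  proof -
    have "(\<Sum>j\<in>S. \<Sum>k\<in>S. s / (1 + s * (z - 1)) * (c s j * c s k) * B j k) =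
      s / (1 + s * (z - 1)) * (\<Sum>j\<in>S. \<Sum>k\<in>S. c s j * c s k * B j k)"
      by (simp add: sum_distrib_left mult.assoc)
    also have "\<dots> \<ge> 0"
      using that affine_pos[OF assms(3), of s] B by (intro mult_nonneg_nonneg) auto
    finally show ?thesis .
  qed
  ultimately show ?thesis by (rule has_integral_nonneg)
qed simp

section \<open>Global optimality\<close>

lemma sum_matrix_mult: "(\<Sum>i\<in>S. f i) ** A = (\<Sum>i\<in>S. f i ** A)" for A :: "'n::finite op"
  by (simp add: matrix_matrix_mult_def vec_eq_iff sum_distrib_right) (intro allI sum.swap)

lemma matrix_mult_sum: "A ** (\<Sum>i\<in>S. f i) = (\<Sum>i\<in>S. A ** f i)" for A :: "'n::finite op"
  by (simp add: matrix_matrix_mult_def vec_eq_iff sum_distrib_left) (intro allI sum.swap)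

lemma scaleR_matrix_mult: "(c *\<^sub>R A) ** B = c *\<^sub>R (A ** B)" for A :: "'n::finite op"
  by (simp add: matrix_matrix_mult_def vec_eq_iff scaleR_sum_right)

lemma matrix_mult_scaleR: "A ** (c *\<^sub>R B) = c *\<^sub>R (A ** B)" for A :: "'n::finite op"
  by (simp add: matrix_matrix_mult_def vec_eq_iff scaleR_sum_right)

text \<open>For the matrix \<open>U\<close> with columns \<open>e j\<close>, orthonormality says
  \<open>dagger U ** U = mat 1\<close>. A left inverse of a square matrix is a right inverse, and
  \<open>U ** dagger U\<close> is the sum of the projections.\<close>

lemma sum_pvm_of:
  assumes "orthonormal_basis e"
  shows "(\<Sum>j\<in>UNIV. pvm_of e j) = mat 1"
proof -
  define U where "U = (\<chi> i j. e j $ i)"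
  have "dagger U ** U = mat 1"
    using assms
    by (simp add: U_def dagger_def matrix_matrix_mult_def vec_eq_iff mat_def
        orthonormal_basis_def hinner_def)
  then have "U ** dagger U = mat 1"
    by (simp add: matrix_left_right_inverse)
  moreover have "U ** dagger U = (\<Sum>j\<in>UNIV. pvm_of e j)"
    by (simp add: U_def dagger_def matrix_matrix_mult_def vec_eq_iff pvm_of_def ketbra_def)
  ultimately show ?thesis by simp
qed

lemma pos_semidef_ketbra: "pos_semidef (ketbra v v)"
proof -
  have "hinner w (ketbra v v *v w) = of_real ((cmod (hinner v w))\<^sup>2)" for w
    by (simp add: ketbra_mult_vec hinner_scale_right complex_norm_square cnj_hinner
        del: of_real_power)
  then show ?thesis
    by (simp add: pos_semidef_def hermitian_def dagger_ketbra)
qed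

lemma born_pvm_of_pos:
  assumes "pos_def A" "orthonormal_basis e"
  shows "0 < born A (pvm_of e i)"
proof -
  have "pvm_of e i \<noteq> 0"
    using assms(2) trace_ketbra[of "e i" "e i"]
    by (auto simp: orthonormal_basis_def pvm_of_def trace_def)
  then show ?thesis
    using assms(1) by (simp add: pvm_of_def born_pos pos_semidef_ketbra)
qed

lemma finite_povm_pvm_of: "orthonormal_basis e \<Longrightarrow> finite_povm UNIV (pvm_of e)"
  using sum_pvm_of[of e] by (simp add: finite_povm_def pvm_of_def pos_semidef_ketbra)

section \<open>Block decomposition of an operator in a basis\<close>

definition block :: "('n::finite \<Rightarrow> complex ^ 'n) \<Rightarrow> 'n op \<Rightarrow> 'n \<Rightarrow> 'n \<Rightarrow> 'n op" where
  "block e A j k = pvm_of e j ** A ** pvm_of e k"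

lemma block_eq: "block e A j k = ketbra (hinner (e j) (A *v e k) *s e j) (e k)"
  by (simp add: block_def pvm_of_def mult_ketbra ketbra_mult_vec flip: matrix_vector_mul_assoc)

text \<open>Carries the stationarity equation between matrix elements over to Born weights against
  an arbitrary \<open>M\<close>.\<close>

lemma born_block_cong:
  assumes "c *\<^sub>R hinner (e j) (A *v e k) = d *\<^sub>R hinner (e j) (B *v e k)"
  shows "c * born (block e A j k) M = d * born (block e B j k) M"
proof -
  have "c *\<^sub>R block e A j k = ketbra ((c *\<^sub>R hinner (e j) (A *v e k)) *s e j) (e k)" for c A
    by (simp add: block_eq ketbra_def vec_eq_iff)
  then have "c *\<^sub>R block e A j k = d *\<^sub>R block e B j k"
    using assms by simp
  then show ?thesis by (metis born_scaleR_left)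
qed

lemma born_block_identity:
  assumes "orthonormal_basis e"
  shows "born (block e A j k) (mat 1) = (if j = k then born A (pvm_of e j) else 0)"
  using assms
  by (auto simp: block_eq pvm_of_def born_ketbra orthonormal_basis_def hinner_scale_right trace_ketbra
     born_def[of _ "mat 1"])

lemma weighted_block_sum:
  fixes e :: "'n::finite \<Rightarrow> complex ^ 'n"
  shows "(\<Sum>j\<in>UNIV. c j *\<^sub>R pvm_of e j) ** A ** (\<Sum>j\<in>UNIV. c j *\<^sub>R pvm_of e j) =
    (\<Sum>j\<in>UNIV. \<Sum>k\<in>UNIV. (c j * c k) *\<^sub>R block e A j k)"
  by (simp add: sum_matrix_mult matrix_mult_sum scaleR_matrix_mult matrix_mult_scaleR block_def
      scaleR_sum_right) (subst sum.swap, simp add: mult.commute)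

lemma born_block_sum:
  assumes "orthonormal_basis e"
  shows "(\<Sum>j\<in>UNIV. \<Sum>k\<in>UNIV. born (block e A j k) M) = born A M"
  using weighted_block_sum[of "\<lambda>_. 1" e A] sum_pvm_of[OF assms]
  by (simp flip: born_sum_left)

text \<open>The double sum is the Born weight of \<open>D ** A ** D\<close>, where the Hermitian
  \<open>D\<close> has eigenvalues \<open>c\<close> in the basis \<open>e\<close>, and this operator
  is again positive semidefinite. It supplies the hypothesis of
  \<open>ln_gap_form_nonneg\<close>.\<close>

lemma born_block_form_nonneg:
  fixes e :: "'n::finite \<Rightarrow> complex ^ 'n"
  assumes "pos_semidef A" "pos_semidef M"
  shows "0 \<le> (\<Sum>j\<in>UNIV. \<Sum>k\<in>UNIV. c j * c k * born (block e A j k) M)"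
proof -
  define D where "D = (\<Sum>j\<in>UNIV. c j *\<^sub>R pvm_of e j)"
  have D: "dagger D = D"
    by (simp add: D_def dagger_sum dagger_scaleR pvm_of_def dagger_ketbra)
  have "hinner v ((D ** A ** D) *v v) = hinner (D *v v) (A *v (D *v v))" for v
    using hinner_dagger[of v D "A *v (D *v v)"] D
    by (simp add: matrix_vector_mul_assoc[symmetric])
  moreover have "hermitian (D ** A ** D)"
    using assms(1) D by (simp add: hermitian_def pos_semidef_def dagger_mult matrix_mul_assoc)
  ultimately have "pos_semidef (D ** A ** D)"
    using assms(1) by (simp add: pos_semidef_def)
  then have "0 \<le> born (D ** A ** D) M" by (rule born_nonneg[OF _ assms(2)])
  then show ?thesis
    unfolding D_def weighted_block_sum by (simp add: born_sum_left born_scaleR_left)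
qed

text \<open>\<open>dual_op e a A x\<close> is \<open>a (A ln X + ln X A) / 2\<close> for the operator \<open>X\<close> with eigenvalues \<open>x\<close> in the
  basis \<open>e\<close>. The sum of the two such operators is the dual certificate of optimality.\<close>

definition dual_op ::
    "('n::finite \<Rightarrow> complex ^ 'n) \<Rightarrow> real \<Rightarrow> 'n op \<Rightarrow> ('n \<Rightarrow> real) \<Rightarrow> 'n op" where
  "dual_op e a A x = (\<Sum>j\<in>UNIV. \<Sum>k\<in>UNIV. (a * (ln (x j) + ln (x k)) / 2) *\<^sub>R block e A j k)"

text \<open>Off-diagonal blocks are traceless, so only the diagonal logarithms survive.\<close>

lemma born_dual_op_identity:
  assumes "orthonormal_basis e"
  shows "born (dual_op e a A x) (mat 1) = (\<Sum>j\<in>UNIV. a * born A (pvm_of e j) * ln (x j))"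
proof -
  have "born (dual_op e a A x) (mat 1) =
      (\<Sum>j\<in>UNIV. \<Sum>k\<in>UNIV. if j = k then a * born A (pvm_of e j) * ln (x j) else 0)"
    unfolding dual_op_def born_sum_left born_scaleR_left born_block_identity[OF assms]
    by (intro sum.cong) auto
  then show ?thesis by simp
qed

text \<open>Weak duality for a single effect \<open>M\<close>. The gap forms of \<open>A\<close> at
  \<open>x0\<close> and of \<open>B\<close> at \<open>y0\<close> are nonnegative. In their weighted
  sum \<open>stat\<close> gives the divided-difference terms of \<open>A\<close> and
  \<open>B\<close> a common factor, whose coefficient vanishes by the linear constraint; what
  remains is the claim.\<close>

lemma dual_bound:
  fixes e :: "'n::finite \<Rightarrow> complex ^ 'n" and A B M :: "'n op"
  assumes e: "orthonormal_basis e" and A: "pos_semidef A" and B: "pos_semidef B"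
    and M: "pos_semidef M" and ab: "0 < a" "0 < b"
    and x: "\<And>j. 0 < x j" and y: "\<And>j. 0 < y j" and xy: "\<And>j. a * x j + b * y j = 1"
    and x0: "0 < x0" and y0: "0 < y0" and xy0: "a * x0 + b * y0 = 1"
    and stat: "\<And>j k. ln_div_diff (x j) (x k) *\<^sub>R hinner (e j) (A *v e k) =
                ln_div_diff (y j) (y k) *\<^sub>R hinner (e j) (B *v e k)"
  shows "a * ln x0 * born A M + b * ln y0 * born B M \<le>
    born (dual_op e a A x) M + born (dual_op e b B y) M"
proof -
  let ?A = "\<lambda>j k. born (block e A j k) M" and ?B = "\<lambda>j k. born (block e B j k) M"
  have "0 \<le> a * (\<Sum>j\<in>UNIV. \<Sum>k\<in>UNIV. ln_gap x0 (x j) (x k) * ?A j k) +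
      b * (\<Sum>j\<in>UNIV. \<Sum>k\<in>UNIV. ln_gap y0 (y j) (y k) * ?B j k)"
    using ab
    by (intro add_nonneg_nonneg mult_nonneg_nonneg ln_gap_form_nonneg born_block_form_nonneg
        A B M x y x0 y0) auto
  also have "\<dots> = (\<Sum>j\<in>UNIV. \<Sum>k\<in>UNIV.
      a * (ln_gap x0 (x j) (x k) * ?A j k) + b * (ln_gap y0 (y j) (y k) * ?B j k))"
    by (simp add: sum_distrib_left sum.distrib)
  also have "\<dots> = (\<Sum>j\<in>UNIV. \<Sum>k\<in>UNIV.
      (a * (ln (x j) + ln (x k)) / 2) * ?A j k + (b * (ln (y j) + ln (y k)) / 2) * ?B j k
      - (a * ln x0 * ?A j k + b * ln y0 * ?B j k))"
  proof (intro sum.cong refl)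
    fix j k
    define d where "d = ln_div_diff (x j) (x k) * ?A j k"
    have d': "d = ln_div_diff (y j) (y k) * ?B j k"
      unfolding d_def by (rule born_block_cong) (rule stat)
    \<comment> \<open>The divided differences drop out because \<open>a x + b y = 1\<close> at both ends.\<close>
    have "a * (x0 - (x j + x k) / 2) + b * (y0 - (y j + y k) / 2) =
        (a * x0 + b * y0) - ((a * x j + b * y j) + (a * x k + b * y k)) / 2"
      by (simp add: field_simps)
    also have "\<dots> = 0" by (simp add: xy xy0)
    finally have "d * (a * (x0 - (x j + x k) / 2) + b * (y0 - (y j + y k) / 2)) = 0" by simp
    then have "a * (x0 - (x j + x k) / 2) * d + b * (y0 - (y j + y k) / 2) * d = 0"
      by (simp add: algebra_simps)
    moreover have "a * (ln_gap x0 (x j) (x k) * ?A j k) = a * (x0 - (x j + x k) / 2) * d +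
        ((a * (ln (x j) + ln (x k)) / 2) * ?A j k - a * ln x0 * ?A j k)"
      by (simp add: ln_gap_def d_def algebra_simps)
    moreover have "b * (ln_gap y0 (y j) (y k) * ?B j k) = b * (y0 - (y j + y k) / 2) * d +
        ((b * (ln (y j) + ln (y k)) / 2) * ?B j k - b * ln y0 * ?B j k)"
      by (simp add: ln_gap_def d' algebra_simps)
    ultimately show "a * (ln_gap x0 (x j) (x k) * ?A j k) + b * (ln_gap y0 (y j) (y k) * ?B j k) =
      (a * (ln (x j) + ln (x k)) / 2) * ?A j k + (b * (ln (y j) + ln (y k)) / 2) * ?B j k
      - (a * ln x0 * ?A j k + b * ln y0 * ?B j k)"
      by linarith
  qed
  also have "\<dots> = born (dual_op e a A x) M + born (dual_op e b B y) M
      - (a * ln x0 * born A M + b * ln y0 * born B M)"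
    by (simp add: dual_op_def born_sum_left born_scaleR_left sum.distrib sum_subtractf
        born_block_sum[OF e, of A M, symmetric] born_block_sum[OF e, of B M, symmetric]
        sum_distrib_left)
  finally show ?thesis by simp
qed

text \<open>The operator \<open>L\<close> dominates every single term of the mutual information of
  any POVM. Summed over the outcomes its Born weights give \<open>born L (mat 1)\<close>, which is
  the value attained by the PVM.\<close>

lemma globally_optimal_if_stationary:
  fixes e :: "'n::finite \<Rightarrow> complex ^ 'n" and A B :: "'n op" and a b :: real
  defines "p \<equiv> \<lambda>j. born A (pvm_of e j)" and "q \<equiv> \<lambda>j. born B (pvm_of e j)"
  defines "x \<equiv> \<lambda>j. p j / (a * p j + b * q j)" and "y \<equiv> \<lambda>j. q j / (a * p j + b * q j)"
  assumes e: "orthonormal_basis e" and A: "pos_def A" and B: "pos_def B"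
    and ab: "0 < a" "0 < b"
    and stat: "\<And>j k. ln_div_diff (x j) (x k) *\<^sub>R hinner (e j) (A *v e k) =
                ln_div_diff (y j) (y k) *\<^sub>R hinner (e j) (B *v e k)"
  shows "globally_optimal a b A B (pvm_of e)"
proof -
  have psd: "pos_semidef A" "pos_semidef B"
    using A B unfolding pos_def_def pos_semidef_def
    by (metis hinner_zero(1) less_eq_real_def zero_complex.sel(1))+
  have pq: "0 < p j" "0 < q j" for j
    unfolding p_def q_def by (rule born_pvm_of_pos[OF A e], rule born_pvm_of_pos[OF B e])
  have pos: "0 < a * p j + b * q j" for j
    using pq[of j] ab by (simp add: add_pos_pos)
  have x: "0 < x j" and y: "0 < y j" for j
    using pos[of j] pq[of j] by (auto simp: x_def y_def)
  have xy: "a * x j + b * y j = 1" for j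
    using pos[of j] by (simp add: x_def y_def flip: add_divide_distrib)
  define L where "L = dual_op e a A x + dual_op e b B y"
  have info: "pvm_info a b A B (pvm_of e) = born L (mat 1)"
    by (simp add: L_def mutual_info_def born_add_left born_dual_op_identity[OF e] Let_def
        x_def y_def p_def q_def sum.distrib)
  have upper: "mutual_info a b A B Y M \<le> pvm_info a b A B (pvm_of e)"
    if "finite_povm Y M" for Y :: "nat set" and M
  proof -
    have "mutual_info a b A B Y M \<le> (\<Sum>y\<in>Y. born L (M y))"
      unfolding mutual_info_def Let_def
    proof (rule sum_mono)
      fix i assume "i \<in> Y"
      then have Mi: "pos_semidef (M i)" using that by (auto simp: finite_povm_def)
      define p0 q0 where "p0 = born A (M i)" and "q0 = born B (M i)"
      show "a * born A (M i) * ln (born A (M i) / (a * born A (M i) + b * born B (M i))) +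
        b * born B (M i) * ln (born B (M i) / (a * born A (M i) + b * born B (M i))) \<le> born L (M i)"
      \<comment> \<open>A nonzero effect has positive weights because \<open>A\<close> and
        \<open>B\<close> are positive definite, so \<open>dual_bound\<close> applies to its
        normalised weights. For a zero effect both sides are 0.\<close>
      proof (cases "M i = 0")
        case False
        then have pq0: "0 < p0" "0 < q0"
          using A B Mi by (auto simp: p0_def q0_def intro: born_pos)
        then have m0: "0 < a * p0 + b * q0" using ab by (simp add: add_pos_pos)
        have "a * ln (p0 / (a * p0 + b * q0)) * born A (M i) +
            b * ln (q0 / (a * p0 + b * q0)) * born B (M i) \<le>
          born (dual_op e a A x) (M i) + born (dual_op e b B y) (M i)"
          using pq0 m0
          by (intro dual_bound e psd Mi ab x y xy stat)
            (auto simp flip: add_divide_distrib)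
        then show ?thesis
          by (simp add: p0_def q0_def L_def born_add_left mult_ac)
      qed simp
    qed
    also have "\<dots> = pvm_info a b A B (pvm_of e)"
      using that info by (simp add: finite_povm_def flip: born_sum_right)
    finally show ?thesis .
  qed
  \<comment> \<open>The supremum ranges over outcome sets of natural numbers, so the PVM is
    relabelled in order to appear among the competitors.\<close>
  obtain g where g: "bij_betw g {0..<CARD('n)} (UNIV :: 'n set)"
    using ex_bij_betw_nat_finite[OF finite] by blast
  have povm: "finite_povm {0..<CARD('n)} (pvm_of e \<circ> g)"
    using finite_povm_pvm_of[OF e] sum.reindex_bij_betw[OF g, of "pvm_of e"]
    by (simp add: finite_povm_def)
  have same: "mutual_info a b A B {0..<CARD('n)} (pvm_of e \<circ> g) = pvm_info a b A B (pvm_of e)"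
    unfolding mutual_info_def o_def by (rule sum.reindex_bij_betw[OF g])
  show ?thesis
    unfolding globally_optimal_def
  proof (rule antisym)
    show "ereal (pvm_info a b A B (pvm_of e)) \<le>
        (SUP (Y, M)\<in>{(Y :: nat set, M). finite_povm Y M}. ereal (mutual_info a b A B Y M))"
      by (rule SUP_upper2[of "({0..<CARD('n)}, pvm_of e \<circ> g)"]) (use povm same in auto)
    show "(SUP (Y, M)\<in>{(Y :: nat set, M). finite_povm Y M}. ereal (mutual_info a b A B Y M)) \<le>
        ereal (pvm_info a b A B (pvm_of e))"
      by (rule SUP_least) (use upper in auto)
  qed
qed

lemma hinner_diag_real:
  "hermitian A \<Longrightarrow> hinner v (A *v v) = of_real (born A (ketbra v v))"
  using hinner_hermitian[of A v v] by (simp add: born_ketbra complex_eq_iff)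

text \<open>For \<open>x j = x k\<close> the divided differences are the reciprocals of
  \<open>x j\<close> and \<open>y j\<close>, and the claim is the proportionality given by
  \<open>van\<close>, or by the definition of \<open>p\<close> and \<open>q\<close> on the diagonal.
  Otherwise it is the criticality equation divided by \<open>a * (x j - x k)\<close>.\<close>

lemma stationary_if_blocks_vanish:
  fixes e :: "'n::finite \<Rightarrow> complex ^ 'n" and A B :: "'n op" and a b :: real
  defines "p \<equiv> \<lambda>j. born A (pvm_of e j)" and "q \<equiv> \<lambda>j. born B (pvm_of e j)"
  defines "x \<equiv> \<lambda>j. p j / (a * p j + b * q j)" and "y \<equiv> \<lambda>j. q j / (a * p j + b * q j)"
  assumes herm: "hermitian A" "hermitian B" and ab: "0 < a" "0 < b"
    and pq: "\<And>j. 0 < p j" "\<And>j. 0 < q j"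
    and crit: "j \<noteq> k \<Longrightarrow> (a * ln (x j) - a * ln (x k)) *\<^sub>R hinner (e j) (A *v e k) +
        (b * ln (y j) - b * ln (y k)) *\<^sub>R hinner (e j) (B *v e k) = 0"
    and van: "j \<noteq> k \<Longrightarrow> p j / q j = p k / q k \<Longrightarrow>
        hinner (e j) ((A - (p j / q j) *\<^sub>R B) *v e k) = 0"
  shows "ln_div_diff (x j) (x k) *\<^sub>R hinner (e j) (A *v e k) =
                ln_div_diff (y j) (y k) *\<^sub>R hinner (e j) (B *v e k)"
proof -
  have pos: "0 < a * p j + b * q j" for j
    using pq[of j] ab by (simp add: add_pos_pos)
  have x: "0 < x j" and y: "0 < y j" for j
    using pos[of j] pq[of j] by (auto simp: x_def y_def)
  have xy: "a * x j + b * y j = 1" for j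
    using pos[of j] by (simp add: x_def y_def flip: add_divide_distrib)
  have ratio: "p j / q j = x j / y j" for j
    using pos[of j] by (simp add: x_def y_def)
  have x_eq: "x i = (1 - b * y i) / a" and y_eq: "y i = (1 - a * x i) / b" for i
    using xy[of i] ab by (auto simp: field_simps)
  have xy_iff: "x j = x k \<longleftrightarrow> y j = y k"
    using x_eq y_eq by metis
  show ?thesis
  proof (cases "x j = x k")
    case True
    then have y_same: "y j = y k" using xy_iff by simp
    have *: "hinner (e j) (A *v e k) = (x j / y j) *\<^sub>R hinner (e j) (B *v e k)"
    proof (cases "j = k")
      case True
      have "hinner (e j) (A *v e j) = of_real (p j)" "hinner (e j) (B *v e j) = of_real (q j)"
        using hinner_diag_real herm by (auto simp: p_def q_def pvm_of_def)
      moreover have "p j = x j / y j * q j"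
        using pq[of j] by (simp flip: ratio)
      ultimately show ?thesis using True by (simp add: scaleR_conv_of_real flip: of_real_mult)
    next
      case False
      have "((x j / y j) *\<^sub>R B) *v e k = of_real (x j / y j) *s (B *v e k)"
        by (simp add: matrix_vector_mult_def vec_eq_iff sum_distrib_left)
          (simp add: scaleR_conv_of_real mult_ac)
      then show ?thesis
        using van[OF False] True y_same
        by (simp add: ratio matrix_vector_mult_diff_rdistrib hinner_diff_right hinner_scale_right
            scaleR_conv_of_real)
    qed
    show ?thesis using True y_same x[of k] y[of k]
      by (simp add: ln_div_diff_def *)
  next
    case False
    then have jk: "j \<noteq> k" and yne: "y j \<noteq> y k" using xy_iff by auto
    \<comment> \<open>Since \<open>a * x + b * y\<close> is constant, the increments of its two
      parts are opposite, so \<open>d\<close> serves as denominator for both divided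
      differences.\<close>
    define d where "d = a * (x j - x k)"
    have d: "d \<noteq> 0" "d = - b * (y j - y k)"
      using False ab xy[of j] xy[of k] by (auto simp: d_def algebra_simps)
    have 1: "ln_div_diff (x j) (x k) = (a * ln (x j) - a * ln (x k)) / d"
      using False ab by (simp add: ln_div_diff_def d_def flip: right_diff_distrib)
    have 2: "ln_div_diff (y j) (y k) = - (b * ln (y j) - b * ln (y k)) / d"
      using yne ab unfolding d(2) by (simp add: ln_div_diff_def flip: right_diff_distrib)
    have 3: "(a * ln (x j) - a * ln (x k)) *\<^sub>R hinner (e j) (A *v e k) =
        - (b * ln (y j) - b * ln (y k)) *\<^sub>R hinner (e j) (B *v e k)"
      using crit[OF jk] by (simp only: add_eq_0_iff2 scaleR_minus_left)
    show ?thesis unfolding 1 2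
      using arg_cong[OF 3, of "\<lambda>z. (1 / d) *\<^sub>R z"] by simp
  qed
qed

section \<open>Two-level rotations\<close>

text \<open>Rodrigues' formula: the powers of \<open>X\<close> cycle through \<open>X\<close>,
  \<open>X ** X\<close> and their negatives, so the exponential series splits into the sine and
  cosine series.\<close>

lemma mat_exp_if_cube_eq_minus:
  fixes X :: "'n::finite op"
  assumes X3: "X ** (X ** X) = - X"
  shows "mat_exp (t *\<^sub>R X) = mat 1 + sin t *\<^sub>R X + (1 - cos t) *\<^sub>R (X ** X)"
proof -
  \<comment> \<open>The cycle starts at the first power. At \<open>n = 0\<close> the cosine term
    would contribute \<open>- X ** X\<close> in place of the identity, hence the correction.\<close>
  have term_eq: "(1 / fact n) *\<^sub>R (((**) (t *\<^sub>R X) ^^ n) (mat 1)) =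
      (sin_coeff n *\<^sub>R t ^ n) *\<^sub>R X - (cos_coeff n *\<^sub>R t ^ n) *\<^sub>R (X ** X) +
      (if n = 0 then mat 1 + X ** X else 0)" (is "?T n = ?R n") for n
  proof (induction n)
    case (Suc n)
    have "?T (Suc n) = (t / of_nat (Suc n)) *\<^sub>R (X ** ?T n)"
      by (simp add: scaleR_matrix_mult matrix_mult_scaleR mult_ac)
    also have "X ** ?T n = (sin_coeff n *\<^sub>R t ^ n) *\<^sub>R (X ** X) + (cos_coeff n *\<^sub>R t ^ n) *\<^sub>R X"
    proof -
      have diff: "X ** (U - V) = X ** U - X ** V" for U V :: "'n op"
        using matrix_add_ldistrib[of X "U - V" V] by simp
      have "X ** 0 = 0" by (simp add: matrix_matrix_mult_def vec_eq_iff)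
      then show ?thesis
        unfolding Suc.IH
        by (simp add: matrix_add_ldistrib matrix_mult_scaleR diff X3)
    qed
    also have "(t / of_nat (Suc n)) *\<^sub>R \<dots> = ?R (Suc n)"
      by (simp add: sin_coeff_Suc cos_coeff_Suc scaleR_add_right algebra_simps)
    finally show ?case .
  qed simp
  have "?R sums (sin t *\<^sub>R X - cos t *\<^sub>R (X ** X) + (mat 1 + X ** X))"
    by (intro sums_add sums_diff bounded_linear.sums[OF bounded_linear_scaleR_left]
        sin_converges cos_converges sums_single[of 0 "\<lambda>_. mat 1 + X ** X"])
  then have "(\<lambda>n. ?T n) sums (sin t *\<^sub>R X - cos t *\<^sub>R (X ** X) + (mat 1 + X ** X))"
    unfolding term_eq .
  then show ?thesis
    unfolding mat_exp_def by (simp add: sums_unique[symmetric] algebra_simps)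
qed

text \<open>The velocity of the two-level rotation at angle 0; it exhibits the rotation as a
  geodesic.\<close>

definition two_level_generator ::
    "('n::finite \<Rightarrow> complex ^ 'n) \<Rightarrow> 'n \<Rightarrow> 'n \<Rightarrow> real \<Rightarrow> 'n op" where
  "two_level_generator e j k \<phi> = ketbra (cis \<phi> *s e k) (e j) - ketbra (cis (- \<phi>) *s e j) (e k)"

lemma ketbra_scale_right: "ketbra u (c *s v) = ketbra (cnj c *s u) v"
  by (simp add: ketbra_def vec_eq_iff mult_ac)

lemma minus_mult_vec: "(- A) *v v = - (A *v v)" for A :: "'n::finite op"
  by (simp add: matrix_vector_mult_def vec_eq_iff sum_negf)

lemma mult_vec_minus: "A *v (- v) = - (A *v v)" for A :: "'n::finite op"
  by (simp add: matrix_vector_mult_def vec_eq_iff sum_negf)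

lemma matrix_eq_if_eq_on_basis:
  fixes A B :: "'n::finite op"
  assumes "orthonormal_basis e" "\<And>i. A *v e i = B *v e i"
  shows "A = B"
proof -
  have expand: "C = (\<Sum>i\<in>UNIV. ketbra (C *v e i) (e i))" for C
    using arg_cong[OF sum_pvm_of[OF assms(1)], of "\<lambda>E. C ** E"]
    by (simp add: matrix_mult_sum pvm_of_def mult_ketbra)
  show ?thesis
    by (subst expand[of A], subst expand[of B]) (simp add: assms(2))
qed

lemma hermitian_quadratic_comb:
  assumes "hermitian A"
  shows "born A (ketbra (x *s u + y *s v) (x *s u + y *s v)) =
    (cmod x)\<^sup>2 * born A (ketbra u u) + (cmod y)\<^sup>2 * born A (ketbra v v) +
    2 * Re (cnj x * y * hinner u (A *v v))"
proof -
  have "hinner v (A *v u) = cnj (hinner u (A *v v))"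
    using hinner_hermitian[OF assms] .
  then show ?thesis
    unfolding cmod_power2 born_ketbra
    by (simp add: matrix_vector_right_distrib vector_scalar_commute hinner_add_left
        hinner_add_right hinner_scale_left hinner_scale_right power2_eq_square algebra_simps)
qed

context
  fixes e :: "'n::finite \<Rightarrow> complex ^ 'n" and j k :: 'n and \<phi> :: real
  assumes e: "orthonormal_basis e" and jk: "j \<noteq> k"
begin

lemma hinner_basis: "hinner (e i) (e l) = (if i = l then 1 else 0)"
  using e by (simp add: orthonormal_basis_def)

lemma two_level_generator_mult_basis:
  "two_level_generator e j k \<phi> *v e i =
    (if i = j then cis \<phi> *s e k else if i = k then - (cis (- \<phi>) *s e j) else 0)"
  using jk
  by (simp add: two_level_generator_def matrix_vector_mult_diff_rdistrib ketbra_mult_vec hinner_basis)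

lemma dagger_two_level_generator:
  "dagger (two_level_generator e j k \<phi>) = - two_level_generator e j k \<phi>"
  by (simp add: two_level_generator_def dagger_diff dagger_ketbra ketbra_scale_right cis_cnj)

lemma two_level_generator_tangent: "two_level_generator e j k \<phi> \<in> tangent (pvm_of e)"
proof -
  have "hinner (e i) (two_level_generator e j k \<phi> *v e i) = 0" for i
    using jk by (simp add: two_level_generator_mult_basis hinner_scale_right hinner_basis
        hinner_diff_right[of _ 0, simplified])
  then have "block e (two_level_generator e j k \<phi>) i i = 0" for i
    by (simp add: block_eq ketbra_def vec_eq_iff)
  then show ?thesis
    by (simp add: tangent_def dagger_two_level_generator block_def)
qed

lemma two_level_generator_sq_mult_basis:
  "(two_level_generator e j k \<phi> ** two_level_generator e j k \<phi>) *v e i =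
    (if i = j \<or> i = k then - e i else 0)"
  using jk
  by (auto simp: matrix_vector_mul_assoc[symmetric] two_level_generator_mult_basis
      vector_scalar_commute mult_vec_minus cis_mult vector_smult_assoc)

text \<open>The square acts as -1 on the plane of \<open>e j\<close> and \<open>e k\<close>, which
  contains the range of the generator.\<close>

lemma two_level_generator_cube:
  "two_level_generator e j k \<phi> ** (two_level_generator e j k \<phi> ** two_level_generator e j k \<phi>) =
    - two_level_generator e j k \<phi>"
proof (rule matrix_eq_if_eq_on_basis[OF e])
  show "(two_level_generator e j k \<phi> **
      (two_level_generator e j k \<phi> ** two_level_generator e j k \<phi>)) *v e i =
    - two_level_generator e j k \<phi> *v e i" for i
    unfolding matrix_vector_mul_assoc[symmetric, of "two_level_generator e j k \<phi>"
      "two_level_generator e j k \<phi> ** two_level_generator e j k \<phi>"]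
      two_level_generator_sq_mult_basis
    by (auto simp: minus_mult_vec mult_vec_minus two_level_generator_mult_basis)
qed

lemma mat_exp_two_level_generator:
  "mat_exp (t *\<^sub>R two_level_generator e j k \<phi>) *v e i = two_level_rotation e j k \<phi> t i"
proof -
  have sc: "(c *\<^sub>R A) *v v = of_real c *s (A *v v)" for c and A :: "'n op" and v
    by (simp add: matrix_vector_mult_def vec_eq_iff sum_distrib_left)
      (simp add: scaleR_conv_of_real mult_ac)
  have "mat_exp (t *\<^sub>R two_level_generator e j k \<phi>) *v e i = e i +
      of_real (sin t) *s
        (if i = j then cis \<phi> *s e k else if i = k then - (cis (- \<phi>) *s e j) else 0) +
      of_real (1 - cos t) *s (if i = j \<or> i = k then - e i else 0)"
    unfolding mat_exp_if_cube_eq_minus[OF two_level_generator_cube]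
    by (simp only: matrix_vector_mult_add_rdistrib sc two_level_generator_mult_basis
        two_level_generator_sq_mult_basis matrix_vector_mul_lid)
  also have "\<dots> = two_level_rotation e j k \<phi> t i"
  proof -
    consider "i = j" | "i = k" | "i \<noteq> j" "i \<noteq> k" by blast
    then show ?thesis
      by cases (use jk in \<open>simp_all add: two_level_rotation_def vec_eq_iff algebra_simps\<close>)
  qed
  finally show ?thesis .
qed

lemma dagger_mat_exp_two_level_generator:
  "dagger (mat_exp (t *\<^sub>R two_level_generator e j k \<phi>)) =
    mat_exp (- (t *\<^sub>R two_level_generator e j k \<phi>))"
proof -
  have "dagger (two_level_generator e j k \<phi> ** two_level_generator e j k \<phi>) =
      two_level_generator e j k \<phi> ** two_level_generator e j k \<phi>"
    by (simp add: dagger_mult dagger_two_level_generator)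
      (simp add: matrix_matrix_mult_def vec_eq_iff)
  then show ?thesis
    unfolding mat_exp_if_cube_eq_minus[OF two_level_generator_cube] scaleR_minus_left[symmetric]
    by (simp add: dagger_add dagger_scaleR dagger_two_level_generator)
qed

text \<open>Links the abstract notions to rotations: through it \<open>critical\<close> and
  \<open>has_hessian\<close> give the first and second derivatives along
  \<open>two_level_rotation\<close>. The inverse exponential is the dagger, so conjugation moves
  both vectors of a \<open>ketbra\<close> alike.\<close>

lemma geodesic_two_level_generator:
  "geodesic (pvm_of e) (two_level_generator e j k \<phi>) t = pvm_of (two_level_rotation e j k \<phi> t)"
proof
  fix i
  have "dagger (dagger A) = A" for A :: "'n op"
    by (simp add: dagger_def vec_eq_iff)
  then show "geodesic (pvm_of e) (two_level_generator e j k \<phi>) t i =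
      pvm_of (two_level_rotation e j k \<phi> t) i"
    by (simp add: geodesic_def pvm_of_def mult_ketbra ketbra_mult mat_exp_two_level_generator
        flip: dagger_mat_exp_two_level_generator)
qed

lemma two_level_rotation_0: "two_level_rotation e j k \<phi> 0 = e"
  by (simp add: two_level_rotation_def fun_eq_iff)

lemma orthonormal_basis_two_level_rotation:
  "orthonormal_basis (two_level_rotation e j k \<phi> t)"
proof -
  define c z where "c = complex_of_real (cos t)" and "z = cis \<phi> * complex_of_real (sin t)"
  define u v where "u = c *s e j + z *s e k" and "v = (- cnj z) *s e j + c *s e k"
  have rot: "two_level_rotation e j k \<phi> t i = (if i = j then u else if i = k then v else e i)" for i
    using jk by (simp add: two_level_rotation_def u_def v_def c_def z_def cis_cnj)
  have "cnj z * z = complex_of_real ((cmod z)\<^sup>2)"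
    by (simp only: complex_norm_square mult.commute)
  also have "(cmod z)\<^sup>2 = (sin t)\<^sup>2"
    by (simp add: z_def norm_mult)
  finally have "cnj z * z = complex_of_real ((sin t)\<^sup>2)" .
  then have "cnj c * c + cnj z * z = complex_of_real ((cos t)\<^sup>2 + (sin t)\<^sup>2)"
    by (simp only: c_def complex_cnj_complex_of_real of_real_add power2_eq_square of_real_mult)
  then have cz: "cnj c * c + cnj z * z = 1" by simp
  have c: "cnj c = c" by (simp add: c_def)
  have "hinner u u = cnj c * c + cnj z * z" "hinner v v = cnj c * c + cnj z * z"
    using jk unfolding u_def v_def hinner_add_left hinner_add_right hinner_scale_left
      hinner_scale_right hinner_basis by simp_all
  then have "hinner u u = 1" "hinner v v = 1" using cz by simp_all
  moreover have "hinner u v = 0" "hinner v u = 0"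
    using jk unfolding u_def v_def hinner_add_left hinner_add_right hinner_scale_left
      hinner_scale_right hinner_basis by (simp_all add: c)
  moreover have "hinner (e i) u = 0" "hinner (e i) v = 0" "hinner u (e i) = 0" "hinner v (e i) = 0"
    if "i \<noteq> j" "i \<noteq> k" for i
    using that unfolding u_def v_def hinner_add_left hinner_add_right hinner_scale_left
      hinner_scale_right hinner_basis by auto
  ultimately show ?thesis
    using jk unfolding orthonormal_basis_def rot by (simp add: hinner_basis)
qed

text \<open>Double angles turn the weights into trigonometric polynomials that are easy to
  differentiate. The phase enters only through the real part of
  \<open>cis \<phi> * \<alpha>\<close>.\<close>

lemma born_two_level_rotation:
  fixes A :: "'n op"
  assumes A: "hermitian A"
  defines "p \<equiv> \<lambda>i. born A (pvm_of e i)" and "\<alpha> \<equiv> hinner (e j) (A *v e k)"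
  shows "born A (pvm_of (two_level_rotation e j k \<phi> t) i) =
    (if i = j then (p j + p k) / 2 + (p j - p k) / 2 * cos (2 * t) + Re (cis \<phi> * \<alpha>) * sin (2 * t)
     else if i = k then (p j + p k) / 2 - (p j - p k) / 2 * cos (2 * t) - Re (cis \<phi> * \<alpha>) * sin (2 * t)
     else p i)"
proof -
  have sq: "(sin t)\<^sup>2 = 1 - (cos t)\<^sup>2" by (simp add: sin_squared_eq)
  have half: "(cos t)\<^sup>2 * u + (sin t)\<^sup>2 * v = (u + v) / 2 + (u - v) / 2 * cos (2 * t)" for u v
    unfolding cos_double sq by (simp add: field_simps)
  consider "i = j" | "i = k" | "i \<noteq> j" "i \<noteq> k" by blast
  then show ?thesis
  proof cases
    case 1
    have "born A (pvm_of (two_level_rotation e j k \<phi> t) j) =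
        (cos t)\<^sup>2 * p j + (sin t)\<^sup>2 * p k +
        2 * Re (complex_of_real (cos t) * (cis \<phi> * complex_of_real (sin t)) * \<alpha>)"
      using jk by (simp add: pvm_of_def two_level_rotation_def hermitian_quadratic_comb[OF A]
          norm_mult p_def \<alpha>_def)
    also have "complex_of_real (cos t) * (cis \<phi> * complex_of_real (sin t)) * \<alpha> =
        complex_of_real (cos t * sin t) * (cis \<phi> * \<alpha>)"
      by (simp add: mult_ac)
    finally show ?thesis
      using 1 by (simp add: half sin_double)
  next
    case 2
    have "two_level_rotation e j k \<phi> t k =
        (- (cis (- \<phi>) * complex_of_real (sin t))) *s e j + complex_of_real (cos t) *s e k"
      by (simp add: two_level_rotation_def)
    then have "born A (pvm_of (two_level_rotation e j k \<phi> t) k) =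
        (sin t)\<^sup>2 * p j + (cos t)\<^sup>2 * p k +
        2 * Re (cnj (- (cis (- \<phi>) * complex_of_real (sin t))) * complex_of_real (cos t) * \<alpha>)"
      by (simp only: pvm_of_def hermitian_quadratic_comb[OF A])
        (simp add: norm_mult p_def \<alpha>_def pvm_of_def)
    also have "cnj (- (cis (- \<phi>) * complex_of_real (sin t))) * complex_of_real (cos t) * \<alpha> =
        complex_of_real (- (cos t * sin t)) * (cis \<phi> * \<alpha>)"
      by (simp add: mult_ac cis_cnj)
    also have "(sin t)\<^sup>2 * p j + (cos t)\<^sup>2 * p k = (p j + p k) / 2 - (p j - p k) / 2 * cos (2 * t)"
      using half[of "p k" "p j"] by (simp add: add.commute field_simps)
    finally show ?thesis
      using 2 jk by (simp add: sin_double)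
  next
    case 3
    then show ?thesis by (simp add: two_level_rotation_def p_def pvm_of_def)
  qed
qed

end

section \<open>Derivatives of the mutual information\<close>

lemma K_kernel_eq:
  fixes a b t :: real
  assumes "0 < a" "0 < b" "a + b = 1" "0 < t"
  shows "K_kernel a b t = a * b / (2 * t * (a * t + b))"
proof -
  have y: "0 < (1 - s) * t + s" if "0 \<le> s" "s \<le> 1" for s
    using that assms by (cases "s = 0") (auto intro: add_nonneg_pos)
  have yb: "(1 - b) * t + b = a * t + b" using assms(3) by (simp add: algebra_simps flip: assms(3))
  \<comment> \<open>Antiderivatives on the two linear pieces of the weight: the quotients being
    squared have derivatives \<open>t\<close> and -1 over the squared denominator. They are
    normalised to vanish at 0 and at 1, so only the values at \<open>b\<close> contribute.\<close>
  define F1 where "F1 s = a / (2 * t) * (s / ((1 - s) * t + s))\<^sup>2" for s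
  define F2 where "F2 s = - b / 2 * ((1 - s) / ((1 - s) * t + s))\<^sup>2" for s
  have D1: "(F1 has_real_derivative w_kernel a b s / ((1 - s) * t + s) ^ 3) (at s within {0..b})"
    if "s \<in> {0..b}" for s
  proof -
    have "0 < (1 - s) * t + s" using that assms by (intro y) auto
    then have "((\<lambda>s. (s / ((1 - s) * t + s))) has_real_derivative t / ((1 - s) * t + s)\<^sup>2)
        (at s within {0..b})"
      by (auto intro!: derivative_eq_intros simp: field_simps power2_eq_square)
    from DERIV_cmult[OF DERIV_power[OF this, of 2], of "a / (2 * t)"]
    show ?thesis unfolding F1_def
    proof (rule DERIV_cong)
      have "a / (2 * t) * (of_nat 2 * (t / y\<^sup>2 * (s / y) ^ (2 - Suc 0))) = a * s / y ^ 3"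
        if "0 < y" for y
        using that assms(4) by (simp add: power2_eq_square power3_eq_cube)
      moreover have "w_kernel a b s = a * s"
        using that by (simp add: w_kernel_def)
      ultimately show "a / (2 * t) * (of_nat 2 * (t / ((1 - s) * t + s)\<^sup>2 *
          (s / ((1 - s) * t + s)) ^ (2 - Suc 0))) = w_kernel a b s / ((1 - s) * t + s) ^ 3"
        using \<open>0 < (1 - s) * t + s\<close> by metis
    qed
  qed
  have D2: "(F2 has_real_derivative w_kernel a b s / ((1 - s) * t + s) ^ 3) (at s within {b..1})"
    if "s \<in> {b..1}" for s
  proof -
    have "0 < (1 - s) * t + s" using that assms by (intro y) auto
    then have "((\<lambda>s. ((1 - s) / ((1 - s) * t + s))) has_real_derivative - 1 / ((1 - s) * t + s)\<^sup>2)
        (at s within {b..1})"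
      by (auto intro!: derivative_eq_intros simp: field_simps power2_eq_square)
    from DERIV_cmult[OF DERIV_power[OF this, of 2], of "- b / 2"]
    show ?thesis unfolding F2_def
    proof (rule DERIV_cong)
      \<comment> \<open>At \<open>s = b\<close> the weight is defined by its other branch; both
        agree there.\<close>
      have "1 - b = a" using assms(3) by simp
      then have "s = b \<Longrightarrow> a * s = b * (1 - s)" by simp
      then have "w_kernel a b s = b * (1 - s)"
        using that by (auto simp: w_kernel_def)
      moreover have "- b / 2 * (of_nat 2 * (- 1 / y\<^sup>2 * (n / y) ^ (2 - Suc 0))) = b * n / y ^ 3"
        for n y by (simp add: power2_eq_square power3_eq_cube)
      ultimately show "- b / 2 * (of_nat 2 * (- 1 / ((1 - s) * t + s)\<^sup>2 *
          ((1 - s) / ((1 - s) * t + s)) ^ (2 - Suc 0))) =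
        w_kernel a b s / ((1 - s) * t + s) ^ 3"
        by metis
    qed
  qed
  have "((\<lambda>s. w_kernel a b s / ((1 - s) * t + s) ^ 3) has_integral F1 b - F1 0) {0..b}"
    using assms by (intro fundamental_theorem_of_calculus)
      (auto simp flip: has_real_derivative_iff_has_vector_derivative intro!: D1)
  moreover have "((\<lambda>s. w_kernel a b s / ((1 - s) * t + s) ^ 3) has_integral F2 1 - F2 b) {b..1}"
    using assms by (intro fundamental_theorem_of_calculus)
      (auto simp flip: has_real_derivative_iff_has_vector_derivative intro!: D2)
  ultimately have "((\<lambda>s. w_kernel a b s / ((1 - s) * t + s) ^ 3) has_integral
      (F1 b - F1 0) + (F2 1 - F2 b)) {0..1}"
    using assms by (intro has_integral_combine[of 0 b 1]) auto
  then have "K_kernel a b t = F1 b - F1 0 + (F2 1 - F2 b)"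
    unfolding K_kernel_def by (rule integral_unique)
  also have "\<dots> = a / (2 * t) * (b / (a * t + b))\<^sup>2 + b / 2 * (a / (a * t + b))\<^sup>2"
  proof -
    have "1 - b = a" using assms(3) by simp
    then show ?thesis using yb by (simp add: F1_def F2_def)
  qed
  also have "\<dots> = a * b * (a * t + b) / (2 * t * (a * t + b)\<^sup>2)"
  proof -
    have "a / (2 * t) * (b / y)\<^sup>2 + b / 2 * (a / y)\<^sup>2 = a * b * (a * t + b) / (2 * t * y\<^sup>2)"
      if "0 < y" for y
      using that assms(4) by (simp add: field_simps power2_eq_square)
    then show ?thesis using assms by (simp add: add_pos_pos)
  qed
  also have "\<dots> = a * b / (2 * t * (a * t + b))"
    using assms by (simp add: power2_eq_square)
  finally show ?thesis .
qed

section \<open>Second derivatives of functions of one real variable\<close>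

lemma has_second_deriv_unique:
  assumes "has_second_deriv f D x" "has_second_deriv f D' x"
  shows "D = D'"
proof -
  from assms obtain f1 f2 where
    f1: "\<forall>\<^sub>F y in nhds x. (f has_real_derivative f1 y) (at y)" "(f1 has_real_derivative D) (at x)" and
    f2: "\<forall>\<^sub>F y in nhds x. (f has_real_derivative f2 y) (at y)" "(f2 has_real_derivative D') (at x)"
    unfolding has_second_deriv_def by blast
  have "\<forall>\<^sub>F y in nhds x. f1 y = f2 y"
    using f1(1) f2(1) by eventually_elim (rule DERIV_unique)
  then have "(f1 has_real_derivative D') (at x)"
    using f2(2) DERIV_cong_ev[OF refl _ refl] by blast
  with f1(2) show ?thesis by (rule DERIV_unique)
qed

text \<open>The first derivative vanishes at \<open>x\<close> and is positive just to its right, so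
  by the mean value theorem \<open>f\<close> exceeds \<open>f x\<close> there.\<close>

lemma not_local_max_if_second_deriv_pos:
  assumes "has_second_deriv f D x" "0 < D" "(f has_real_derivative 0) (at x)"
  shows "\<not> (\<forall>\<^sub>F y in nhds x. f y \<le> f x)"
proof
  assume max: "\<forall>\<^sub>F y in nhds x. f y \<le> f x"
  from assms(1) obtain f' where
    f': "\<forall>\<^sub>F y in nhds x. (f has_real_derivative f' y) (at y)" "(f' has_real_derivative D) (at x)"
    unfolding has_second_deriv_def by blast
  have "f' x = 0"
    using DERIV_unique[OF eventually_nhds_x_imp_x[OF f'(1)] assms(3)] .
  obtain d where d: "0 < d" "\<And>h. 0 < h \<Longrightarrow> h < d \<Longrightarrow> f' x < f' (x + h)"
    using DERIV_pos_inc_right[OF f'(2) assms(2)] by blast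
  from eventually_conj[OF max f'(1)] obtain e where e: "0 < e"
    "\<And>y. dist y x < e \<Longrightarrow> f y \<le> f x \<and> (f has_real_derivative f' y) (at y)"
    unfolding eventually_nhds_metric by blast
  define h where "h = min d e / 2"
  have h: "0 < h" "h < d" "h < e" using d(1) e(1) by (auto simp: h_def)
  have "\<exists>z>x. z < x + h \<and> f (x + h) - f x = (x + h - x) * f' z"
    using h by (intro MVT2) (auto intro!: e(2)[THEN conjunct2] simp: dist_real_def)
  then obtain z where z: "x < z" "z < x + h" "f (x + h) - f x = h * f' z"
    by auto
  have "0 < f' z" using d(2)[of "z - x"] z h \<open>f' x = 0\<close> by auto
  then have "f x < f (x + h)" using z h by (metis diff_gt_0_iff_gt mult_pos_pos)
  moreover have "f (x + h) \<le> f x" using e(2)[of "x + h"] h by (simp add: dist_real_def)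
  ultimately show False by simp
qed

section \<open>The contribution of one outcome and its derivatives\<close>

definition info_term :: "real \<Rightarrow> real \<Rightarrow> real \<Rightarrow> real \<Rightarrow> real" where
  "info_term a b p q = a * p * ln (p / (a * p + b * q)) + b * q * ln (q / (a * p + b * q))"

lemma pvm_info_eq:
  "pvm_info a b A B P = (\<Sum>i\<in>UNIV. info_term a b (born A (P i)) (born B (P i)))"
  by (simp add: mutual_info_def info_term_def Let_def)

lemma ln_ratio_has_derivative:
  fixes f g :: "real \<Rightarrow> real"
  assumes f: "(f has_real_derivative f') (at t)" and g: "(g has_real_derivative g') (at t)"
    and pos: "0 < f t" "0 < g t"
  shows "((\<lambda>t. ln (f t / g t)) has_real_derivative f' / f t - g' / g t) (at t)"
proof -
  have "((\<lambda>t. f t / g t) has_real_derivative (f' * g t - f t * g') / (g t * g t)) (at t)"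
    using pos by (intro derivative_intros f g) auto
  then have "((\<lambda>t. ln (f t / g t)) has_real_derivative
      1 / (f t / g t) * ((f' * g t - f t * g') / (g t * g t))) (at t)"
    using pos by (intro DERIV_chain2[OF DERIV_ln_divide]) auto
  moreover have "1 / (f t / g t) * ((f' * g t - f t * g') / (g t * g t)) = f' / f t - g' / g t"
    using pos by (simp add: field_simps)
  ultimately show ?thesis by simp
qed

text \<open>The logarithms may be treated as constants: with \<open>m = a * p + b * q\<close>, their
  derivatives contribute \<open>a * p' + b * q'\<close> minus the derivative of \<open>m\<close>,
  which is zero.\<close>

lemma info_term_has_derivative:
  fixes p q :: "real \<Rightarrow> real"
  assumes "0 < a" "0 < b" "0 < p t" "0 < q t"
    and p: "(p has_real_derivative p') (at t)" and q: "(q has_real_derivative q') (at t)"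
  shows "((\<lambda>t. info_term a b (p t) (q t)) has_real_derivative
    a * ln (p t / (a * p t + b * q t)) * p' + b * ln (q t / (a * p t + b * q t)) * q') (at t)"
proof -
  define m where "m = a * p t + b * q t"
  have m: "0 < m" using assms by (simp add: m_def add_pos_pos)
  have m': "((\<lambda>t. a * p t + b * q t) has_real_derivative a * p' + b * q') (at t)"
    by (auto intro!: derivative_eq_intros p q)
  have lnp: "((\<lambda>t. ln (p t / (a * p t + b * q t))) has_real_derivative
      p' / p t - (a * p' + b * q') / m) (at t)"
    using ln_ratio_has_derivative[OF p m'] m assms(3) by (simp add: m_def)
  have lnq: "((\<lambda>t. ln (q t / (a * p t + b * q t))) has_real_derivative
      q' / q t - (a * p' + b * q') / m) (at t)"
    using ln_ratio_has_derivative[OF q m'] m assms(4) by (simp add: m_def)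
  have "(p' / p t - c / m) * (a * p t) + (q' / q t - c / m) * (b * q t) =
      a * p' + b * q' - c * ((a * p t + b * q t) / m)" for c
    using assms(3,4) m by (simp add: field_simps)
  then have "(p' / p t - (a * p' + b * q') / m) * (a * p t) +
      (q' / q t - (a * p' + b * q') / m) * (b * q t) =
      a * p' + b * q' - (a * p' + b * q') * (m / m)"
    by (simp only: m_def)
  also have "\<dots> = 0" using m by simp
  finally have "a * p' * ln (p t / m) + (p' / p t - (a * p' + b * q') / m) * (a * p t) +
      (b * q' * ln (q t / m) + (q' / q t - (a * p' + b * q') / m) * (b * q t)) =
      a * ln (p t / m) * p' + b * ln (q t / m) * q'"
    by (simp add: algebra_simps)
  then show ?thesis
    unfolding info_term_def
    by (intro DERIV_cong[OF DERIV_add[OF DERIV_mult[OF DERIV_cmult[OF p] lnp]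
            DERIV_mult[OF DERIV_cmult[OF q] lnq]]]) (simp add: m_def)
qed

lemma info_term_derivative_has_derivative:
  fixes p q p' q' :: "real \<Rightarrow> real"
  assumes "0 < a" "0 < b" "0 < p t" "0 < q t"
    and p: "(p has_real_derivative p' t) (at t)" and q: "(q has_real_derivative q' t) (at t)"
    and p': "(p' has_real_derivative p'') (at t)" and q': "(q' has_real_derivative q'') (at t)"
  shows "((\<lambda>t. a * ln (p t / (a * p t + b * q t)) * p' t + b * ln (q t / (a * p t + b * q t)) * q' t)
    has_real_derivative
    a * ln (p t / (a * p t + b * q t)) * p'' + b * ln (q t / (a * p t + b * q t)) * q'' +
    a * b * (p' t * q t - p t * q' t)\<^sup>2 / (p t * q t * (a * p t + b * q t))) (at t)"
proof -
  define m where "m = a * p t + b * q t"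
  have m: "0 < m" using assms by (simp add: m_def add_pos_pos)
  have m': "((\<lambda>t. a * p t + b * q t) has_real_derivative a * p' t + b * q' t) (at t)"
    by (auto intro!: derivative_eq_intros p q)
  have lnp: "((\<lambda>t. ln (p t / (a * p t + b * q t))) has_real_derivative
      p' t / p t - (a * p' t + b * q' t) / m) (at t)"
    using ln_ratio_has_derivative[OF p m'] m assms(3) by (simp add: m_def)
  have lnq: "((\<lambda>t. ln (q t / (a * p t + b * q t))) has_real_derivative
      q' t / q t - (a * p' t + b * q' t) / m) (at t)"
    using ln_ratio_has_derivative[OF q m'] m assms(4) by (simp add: m_def)
  have "((\<lambda>t. a * ln (p t / (a * p t + b * q t)) * p' t + b * ln (q t / (a * p t + b * q t)) * q' t)
    has_real_derivative
    a * ln (p t / m) * p'' + b * ln (q t / m) * q'' +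
    (a * (p' t / p t - (a * p' t + b * q' t) / m) * p' t +
     b * (q' t / q t - (a * p' t + b * q' t) / m) * q' t)) (at t)"
    by (rule DERIV_cong[OF DERIV_add[OF DERIV_mult[OF DERIV_cmult[OF lnp] p']
            DERIV_mult[OF DERIV_cmult[OF lnq] q']]])
      (simp add: m_def[symmetric] algebra_simps)
  moreover have "a * (u / x - (a * u + b * v) / (a * x + b * y)) * u +
     b * (v / y - (a * u + b * v) / (a * x + b * y)) * v =
     a * b * (u * y - x * v)\<^sup>2 / (x * y * (a * x + b * y))"
    if "0 < x" "0 < y" "0 < a * x + b * y" for u v x y :: real
  proof -
    define n w where "n = a * x + b * y" and "w = u * y - x * v"
    have n: "0 < n" using that by (simp add: n_def)
    \<comment> \<open>Both logarithmic derivatives are multiples of the Wronskian \<open>w\<close>,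
      which is why the sum is a perfect square over a positive denominator.\<close>
    have "u * n - (a * u + b * v) * x = b * w" "v * n - (a * u + b * v) * y = - (a * w)"
      by (simp_all add: n_def w_def algebra_simps)
    then have 1: "u / x - (a * u + b * v) / n = b * w / (x * n)"
      and 2: "v / y - (a * u + b * v) / n = - (a * w) / (y * n)"
      using that n by (simp_all only: diff_frac_eq less_imp_neq[symmetric] simp_thms)
    have "a * (b * w / (x * n)) * u + b * (- (a * w) / (y * n)) * v =
        a * b * w * (u * y - x * v) / (x * y * n)"
      using that n by (simp add: field_simps)
    then show ?thesis
      unfolding n_def[symmetric] 1 2 by (simp add: w_def power2_eq_square mult_ac)
  qed
  ultimately show ?thesis
    using assms m unfolding m_def[symmetric] by (simp add: m_def)
qed

text \<open>The profile of a Born weight along a rotation, with \<open>s\<close> the sum and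
  \<open>d\<close> the difference of the two initial weights and \<open>r\<close> the off-diagonal
  part. Outcome \<open>k\<close> has the signs of \<open>d\<close> and \<open>r\<close>
  reversed.\<close>

definition rot_weight :: "real \<Rightarrow> real \<Rightarrow> real \<Rightarrow> real \<Rightarrow> real" where
  "rot_weight s d r t = s / 2 + d / 2 * cos (2 * t) + r * sin (2 * t)"

definition rot_slope :: "real \<Rightarrow> real \<Rightarrow> real \<Rightarrow> real" where
  "rot_slope d r t = - d * sin (2 * t) + 2 * r * cos (2 * t)"

lemma rot_weight_has_derivative:
  "(rot_weight s d r has_real_derivative rot_slope d r t) (at t)"
  unfolding rot_weight_def[abs_def] rot_slope_def by (auto intro!: derivative_eq_intros)

lemma rot_slope_has_derivative_0:
  "(rot_slope d r has_real_derivative - 2 * d) (at 0)"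
  unfolding rot_slope_def[abs_def] by (auto intro!: derivative_eq_intros)

text \<open>Only the outcomes \<open>j\<close> and \<open>k\<close> move, and the changes of their
  weights are opposite. When both likelihood ratios equal \<tau> the logarithms at \<open>j\<close>
  and \<open>k\<close> coincide, so the terms with second derivatives of the weights cancel and only
  the squared Wronskians remain.\<close>

lemma
  fixes e :: "'n::finite \<Rightarrow> complex ^ 'n" and j k :: 'n and A B :: "'n op" and a b \<phi> :: real
  defines "p \<equiv> \<lambda>i. born A (pvm_of e i)" and "q \<equiv> \<lambda>i. born B (pvm_of e i)"
  defines "f \<equiv> \<lambda>t. pvm_info a b A B (pvm_of (two_level_rotation e j k \<phi> t))"
    and "A0 \<equiv> Re (cis \<phi> * hinner (e j) (A *v e k))"
    and "B0 \<equiv> Re (cis \<phi> * hinner (e j) (B *v e k))"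
  assumes e: "orthonormal_basis e" and jk: "j \<noteq> k" and A: "pos_def A" and B: "pos_def B"
    and a: "0 < a" and b: "0 < b"
  shows pvm_info_two_level_first: "(f has_real_derivative
      2 * (a * ln (p j / (a * p j + b * q j)) - a * ln (p k / (a * p k + b * q k))) * A0 +
      2 * (b * ln (q j / (a * p j + b * q j)) - b * ln (q k / (a * p k + b * q k))) * B0) (at 0)"
    and pvm_info_two_level_second: "p j = \<tau> * q j \<Longrightarrow> p k = \<tau> * q k \<Longrightarrow>
      has_second_deriv f (4 * a * b * (A0 - \<tau> * B0)\<^sup>2 / (\<tau> * (a * \<tau> + b)) * (1 / q j + 1 / q k)) 0"
proof -
  have herm: "hermitian A" "hermitian B" using A B by (auto simp: pos_def_def)
  define P1 Q1 P2 Q2 where "P1 = rot_weight (p j + p k) (p j - p k) A0"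
    and "Q1 = rot_weight (q j + q k) (q j - q k) B0"
    and "P2 = rot_weight (p j + p k) (p k - p j) (- A0)"
    and "Q2 = rot_weight (q j + q k) (q k - q j) (- B0)"
  define P1' Q1' P2' Q2' where "P1' = rot_slope (p j - p k) A0"
    and "Q1' = rot_slope (q j - q k) B0"
    and "P2' = rot_slope (p k - p j) (- A0)"
    and "Q2' = rot_slope (q k - q j) (- B0)"
  note W = P1_def Q1_def P2_def Q2_def
  note S = P1'_def Q1'_def P2'_def Q2'_def
  have rot: "born A (pvm_of (two_level_rotation e j k \<phi> t) j) = P1 t"
    "born B (pvm_of (two_level_rotation e j k \<phi> t) j) = Q1 t"
    "born A (pvm_of (two_level_rotation e j k \<phi> t) k) = P2 t"
    "born B (pvm_of (two_level_rotation e j k \<phi> t) k) = Q2 t"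
    "i \<noteq> j \<Longrightarrow> i \<noteq> k \<Longrightarrow> born A (pvm_of (two_level_rotation e j k \<phi> t) i) = p i"
    "i \<noteq> j \<Longrightarrow> i \<noteq> k \<Longrightarrow> born B (pvm_of (two_level_rotation e j k \<phi> t) i) = q i" for t i
    using jk by (simp_all add: born_two_level_rotation[OF e jk herm(1)]
        born_two_level_rotation[OF e jk herm(2)] W rot_weight_def p_def q_def A0_def B0_def
        diff_divide_distrib left_diff_distrib)
  have pos: "0 < P1 t" "0 < Q1 t" "0 < P2 t" "0 < Q2 t" for t
    using born_pvm_of_pos[OF A orthonormal_basis_two_level_rotation[OF e jk], of \<phi> t]
      born_pvm_of_pos[OF B orthonormal_basis_two_level_rotation[OF e jk], of \<phi> t] rot
    by metis+
  have f_eq: "f t = info_term a b (P1 t) (Q1 t) + (info_term a b (P2 t) (Q2 t) +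
      (\<Sum>i\<in>UNIV - {j} - {k}. info_term a b (p i) (q i)))" for t
    unfolding f_def pvm_info_eq using jk
    by (simp add: sum.remove[of UNIV j] sum.remove[of "UNIV - {j}" k] rot)
  have dW: "(P1 has_real_derivative P1' t) (at t)" "(Q1 has_real_derivative Q1' t) (at t)"
    "(P2 has_real_derivative P2' t) (at t)" "(Q2 has_real_derivative Q2' t) (at t)" for t
    unfolding W S by (rule rot_weight_has_derivative)+
  have dS: "(P1' has_real_derivative - 2 * (p j - p k)) (at 0)"
    "(Q1' has_real_derivative - 2 * (q j - q k)) (at 0)"
    "(P2' has_real_derivative - 2 * (p k - p j)) (at 0)"
    "(Q2' has_real_derivative - 2 * (q k - q j)) (at 0)"
    unfolding S by (rule rot_slope_has_derivative_0)+
  have at0: "P1 0 = p j" "Q1 0 = q j" "P2 0 = p k" "Q2 0 = q k"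
    "P1' 0 = 2 * A0" "Q1' 0 = 2 * B0" "P2' 0 = - 2 * A0" "Q2' 0 = - 2 * B0"
    by (simp_all add: W S rot_weight_def rot_slope_def field_simps)
  define g where "g t =
    (a * ln (P1 t / (a * P1 t + b * Q1 t)) * P1' t + b * ln (Q1 t / (a * P1 t + b * Q1 t)) * Q1' t) +
    (a * ln (P2 t / (a * P2 t + b * Q2 t)) * P2' t + b * ln (Q2 t / (a * P2 t + b * Q2 t)) * Q2' t)"
    for t
  have f': "(f has_real_derivative g t) (at t)" for t
  proof -
    have "(f has_real_derivative
      (a * ln (P1 t / (a * P1 t + b * Q1 t)) * P1' t + b * ln (Q1 t / (a * P1 t + b * Q1 t)) * Q1' t) +
      ((a * ln (P2 t / (a * P2 t + b * Q2 t)) * P2' t + b * ln (Q2 t / (a * P2 t + b * Q2 t)) * Q2' t)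
        + 0)) (at t)"
      unfolding f_eq
      by (intro DERIV_add info_term_has_derivative DERIV_const a b pos dW)
    then show ?thesis by (simp add: g_def)
  qed
  show "(f has_real_derivative
      2 * (a * ln (p j / (a * p j + b * q j)) - a * ln (p k / (a * p k + b * q k))) * A0 +
      2 * (b * ln (q j / (a * p j + b * q j)) - b * ln (q k / (a * p k + b * q k))) * B0) (at 0)"
    by (rule DERIV_cong[OF f']) (simp add: g_def at0 algebra_simps)
  show "has_second_deriv f (4 * a * b * (A0 - \<tau> * B0)\<^sup>2 / (\<tau> * (a * \<tau> + b)) * (1 / q j + 1 / q k)) 0"
    if pj: "p j = \<tau> * q j" and pk: "p k = \<tau> * q k"
  proof -
    have qpos: "0 < q j" "0 < q k" using pos[of 0] at0 by auto
    have "0 < \<tau> * q j" using pos(1)[of 0] at0(1) pj by simp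
    then have tau: "0 < \<tau>" using qpos by (simp add: zero_less_mult_iff)
    then have n: "0 < a * \<tau> + b" using a b by (simp add: add_pos_pos)
    have m: "a * (\<tau> * x) + b * x = (a * \<tau> + b) * x" for x by (simp add: algebra_simps)
    have "(g has_real_derivative
      (a * ln (P1 0 / (a * P1 0 + b * Q1 0)) * (- 2 * (p j - p k)) +
       b * ln (Q1 0 / (a * P1 0 + b * Q1 0)) * (- 2 * (q j - q k)) +
       a * b * (P1' 0 * Q1 0 - P1 0 * Q1' 0)\<^sup>2 / (P1 0 * Q1 0 * (a * P1 0 + b * Q1 0))) +
      (a * ln (P2 0 / (a * P2 0 + b * Q2 0)) * (- 2 * (p k - p j)) +
       b * ln (Q2 0 / (a * P2 0 + b * Q2 0)) * (- 2 * (q k - q j)) +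
       a * b * (P2' 0 * Q2 0 - P2 0 * Q2' 0)\<^sup>2 / (P2 0 * Q2 0 * (a * P2 0 + b * Q2 0)))) (at 0)"
      (is "(g has_real_derivative ?D) _")
      unfolding g_def[abs_def]
      by (intro DERIV_add[OF info_term_derivative_has_derivative info_term_derivative_has_derivative]
          a b pos dW dS)
    moreover have "?D = 4 * a * b * (A0 - \<tau> * B0)\<^sup>2 / (\<tau> * (a * \<tau> + b)) * (1 / q j + 1 / q k)"
    proof -
      have ratio: "\<tau> * x / ((a * \<tau> + b) * x) = \<tau> / (a * \<tau> + b)"
        "x / ((a * \<tau> + b) * x) = 1 / (a * \<tau> + b)"
        if "0 < x" for x using that by simp_all
      have sq: "a * b * (2 * A0 * x - \<tau> * x * (2 * B0))\<^sup>2 / (\<tau> * x * x * (n * x)) =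
          4 * a * b * (A0 - \<tau> * B0)\<^sup>2 / (\<tau> * n) * (1 / x)" if "0 < x" "0 < n" for x n
      proof -
        have "2 * A0 * x - \<tau> * x * (2 * B0) = 2 * x * (A0 - \<tau> * B0)"
          by (simp add: algebra_simps)
        moreover have "a * b * (2 * x * w)\<^sup>2 / (\<tau> * x * x * (n * x)) =
            4 * a * b * w\<^sup>2 / (\<tau> * n) * (1 / x)"
          for w using that tau by (simp add: field_simps power2_eq_square)
        ultimately show ?thesis by metis
      qed
      have sq': "(- 2 * A0 * x - \<tau> * x * (- 2 * B0))\<^sup>2 = (2 * A0 * x - \<tau> * x * (2 * B0))\<^sup>2" for x
        by (simp add: power2_eq_square algebra_simps)
      have cancel: "(u * (- 2 * (\<tau> * x - \<tau> * y)) + v * (- 2 * (x - y)) + c * (1 / x)) +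
          (u * (- 2 * (\<tau> * y - \<tau> * x)) + v * (- 2 * (y - x)) + c * (1 / y)) = c * (1 / x + 1 / y)"
        for u v c x y by (simp add: algebra_simps)
      show ?thesis
        unfolding at0 pj pk m sq' sq[OF qpos(1) n] sq[OF qpos(2) n]
          ratio[OF qpos(1)] ratio[OF qpos(2)]
        by (rule cancel)
    qed
    ultimately show ?thesis
      unfolding has_second_deriv_def using f' by (auto intro!: exI[of _ g])
  qed
qed

section \<open>From rotations to optimality\<close>

lemma continuous_two_level_rotation_pvm:
  "continuous_on UNIV (\<lambda>t. pvm_of (two_level_rotation e j k \<phi> t))"
proof -
  have "continuous_on UNIV (\<lambda>t. two_level_rotation e j k \<phi> t i $ m)" for i m
    unfolding two_level_rotation_def
    by (cases "i = k"; cases "i = j") (auto intro!: continuous_intros)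
  then have "continuous_on UNIV (\<lambda>t. pvm_of (two_level_rotation e j k \<phi> t) i)" for i
    unfolding pvm_of_def ketbra_def
    by (intro continuous_on_vec_lambda continuous_on_mult continuous_on_cnj)
  then show ?thesis
    by (rule continuous_on_coordinatewise_then_product)
qed

text \<open>The rotation is a continuous curve that stays among the rank-one PVMs, so the
  neighbourhood of the maximum pulls back to one of angle 0.\<close>

lemma local_maximum_two_level:
  fixes e :: "'n::finite \<Rightarrow> complex ^ 'n"
  assumes "local_maximum F (pvm_of e)" "orthonormal_basis e" "j \<noteq> k"
  shows "\<forall>\<^sub>F t in nhds 0. F (pvm_of (two_level_rotation e j k \<phi> t)) \<le>
    F (pvm_of (two_level_rotation e j k \<phi> 0))"
proof -
  let ?c = "\<lambda>t. pvm_of (two_level_rotation e j k \<phi> t)"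
  have "\<forall>\<^sub>F Q in nhds (pvm_of e). Q \<in> rank_one_pvms \<longrightarrow> F Q \<le> F (pvm_of e)"
    using assms(1) unfolding local_maximum_def eventually_at_filter
    by (auto elim!: eventually_mono)
  moreover have "filterlim ?c (nhds (pvm_of e)) (nhds 0)"
    using continuous_two_level_rotation_pvm[of e j k \<phi>]
    by (metis UNIV_I continuous_on_def tendsto_at_iff_tendsto_nhds
        two_level_rotation_0[OF assms(2,3)])
  ultimately have "\<forall>\<^sub>F t in nhds 0. ?c t \<in> rank_one_pvms \<longrightarrow> F (?c t) \<le> F (pvm_of e)"
    by (rule eventually_compose_filterlim)
  then show ?thesis
    using orthonormal_basis_two_level_rotation[OF assms(2,3)]
    by (auto simp: rank_one_pvms_def two_level_rotation_0[OF assms(2,3)] elim!: eventually_mono)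
qed

lemma zero_derivative_if_local_max:
  fixes f :: "real \<Rightarrow> real"
  assumes "(f has_real_derivative D) (at x)" "\<forall>\<^sub>F y in nhds x. f y \<le> f x"
  shows "D = 0"
proof -
  obtain d where "0 < d" "\<And>y. dist y x < d \<Longrightarrow> f y \<le> f x"
    using assms(2) unfolding eventually_nhds_metric by blast
  then show ?thesis
    using DERIV_local_max[OF assms(1), of d] by (simp add: dist_real_def abs_minus_commute)
qed

text \<open>Criticality settles the stationarity equation for pairs in different posterior blocks.
  If the PVM is not optimal, the equation must therefore fail inside a block, and there a nonzero
  off-diagonal element can be turned into ascent.\<close>

lemma exists_ascending_rotation:
  fixes e :: "'n::finite \<Rightarrow> complex ^ 'n" and A B :: "'n op" and a b :: real
  defines "p \<equiv> \<lambda>i. born A (pvm_of e i)" and "q \<equiv> \<lambda>i. born B (pvm_of e i)"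
  assumes e: "orthonormal_basis e" and A: "pos_def A" and B: "pos_def B"
    and ab: "0 < a" "0 < b" "a + b = 1"
    and crit: "\<And>j k \<phi>. j \<noteq> k \<Longrightarrow>
      ((\<lambda>t. pvm_info a b A B (pvm_of (two_level_rotation e j k \<phi> t))) has_real_derivative 0) (at 0)"
    and nopt: "\<not> globally_optimal a b A B (pvm_of e)"
  obtains j k \<tau> \<phi> D where "j \<noteq> k" "p j / q j = \<tau>" "p k / q k = \<tau>"
    "D = 8 * (cmod (hinner (e j) ((A - \<tau> *\<^sub>R B) *v e k)))\<^sup>2 * (1 / q j + 1 / q k) * K_kernel a b \<tau>"
    "has_second_deriv (\<lambda>t. pvm_info a b A B (pvm_of (two_level_rotation e j k \<phi> t))) D 0"
    "0 < D"
proof -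
  have herm: "hermitian A" "hermitian B" using A B by (auto simp: pos_def_def)
  have pq: "0 < p j" "0 < q j" for j
    using born_pvm_of_pos[OF A e] born_pvm_of_pos[OF B e] by (auto simp: p_def q_def)
  define x y where "x j = p j / (a * p j + b * q j)" and "y j = q j / (a * p j + b * q j)" for j
  have stat: "(a * ln (x j) - a * ln (x k)) *\<^sub>R hinner (e j) (A *v e k) +
        (b * ln (y j) - b * ln (y k)) *\<^sub>R hinner (e j) (B *v e k) = 0" (is "?z = 0")
    if "j \<noteq> k" for j k
  proof -
    have *: "Re (cis \<phi> * ?z) = 0" for \<phi>
    proof -
      have "2 * (a * ln (x j) - a * ln (x k)) * Re (cis \<phi> * hinner (e j) (A *v e k)) +
          2 * (b * ln (y j) - b * ln (y k)) * Re (cis \<phi> * hinner (e j) (B *v e k)) = 0"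
        using DERIV_unique[OF pvm_info_two_level_first[OF e that A B ab(1,2), of \<phi>] crit[OF that]]
        by (simp only: x_def y_def p_def q_def)
      then show ?thesis by (simp add: algebra_simps)
    qed
    \<comment> \<open>These two phases give the real part and, up to sign, the imaginary
      part.\<close>
    show ?thesis using *[of 0] *[of "pi / 2"]
      by (simp add: complex_eq_iff)
  qed
  have "\<exists>j k. j \<noteq> k \<and> p j / q j = p k / q k \<and> hinner (e j) ((A - (p j / q j) *\<^sub>R B) *v e k) \<noteq> 0"
  proof (rule ccontr)
    assume "\<not> ?thesis"
    then have "ln_div_diff (x j) (x k) *\<^sub>R hinner (e j) (A *v e k) =
        ln_div_diff (y j) (y k) *\<^sub>R hinner (e j) (B *v e k)" for j k
      unfolding x_def y_def p_def q_def
      by (intro stationary_if_blocks_vanish herm ab)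
        (use pq stat in \<open>auto simp: x_def y_def p_def q_def\<close>)
    then have "globally_optimal a b A B (pvm_of e)"
      by (intro globally_optimal_if_stationary e A B ab) (simp add: x_def y_def p_def q_def)
    with nopt show False by simp
  qed
  then obtain j k where jk: "j \<noteq> k" "p j / q j = p k / q k"
    and off: "hinner (e j) ((A - (p j / q j) *\<^sub>R B) *v e k) \<noteq> 0" by blast
  define \<tau> where "\<tau> = p j / q j"
  define z where "z = hinner (e j) ((A - \<tau> *\<^sub>R B) *v e k)"
  have tau: "0 < \<tau>" using pq by (simp add: \<tau>_def)
  have pj: "p j = \<tau> * q j"
    unfolding \<tau>_def using pq(2)[of j] by simp
  have pk: "p k = \<tau> * q k"
    unfolding \<tau>_def jk(2) using pq(2)[of k] by simp
  \<comment> \<open>This phase makes \<open>cis \<phi> * z\<close> real and nonnegative, so the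
    squared real part in the second derivative becomes the full squared modulus of
    \<open>z\<close>.\<close>
  define \<phi> where "\<phi> = - Arg z"
  have "cis \<phi> * z = of_real (cmod z)"
  proof -
    have "cis \<phi> * z = cis \<phi> * rcis (cmod z) (Arg z)" by (simp only: rcis_cmod_Arg)
    also have "\<dots> = of_real (cmod z)" by (simp add: \<phi>_def rcis_def cis_mult mult.left_commute)
    finally show ?thesis .
  qed
  moreover have "z = hinner (e j) (A *v e k) - of_real \<tau> * hinner (e j) (B *v e k)"
  proof -
    have "(\<tau> *\<^sub>R B) *v e k = of_real \<tau> *s (B *v e k)"
      by (simp add: matrix_vector_mult_def vec_eq_iff sum_distrib_left)
        (simp add: scaleR_conv_of_real mult_ac)
    then show ?thesis
      by (simp add: z_def matrix_vector_mult_diff_rdistrib hinner_diff_right hinner_scale_right)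
  qed
  ultimately have "cmod z =
      Re (cis \<phi> * (hinner (e j) (A *v e k) - of_real \<tau> * hinner (e j) (B *v e k)))"
    by simp
  also have "\<dots> = Re (cis \<phi> * hinner (e j) (A *v e k)) - \<tau> * Re (cis \<phi> * hinner (e j) (B *v e k))"
    by (simp add: algebra_simps)
  finally have z: "Re (cis \<phi> * hinner (e j) (A *v e k)) -
      \<tau> * Re (cis \<phi> * hinner (e j) (B *v e k)) = cmod z"
    by simp
  define D where "D = 8 * (cmod z)\<^sup>2 * (1 / q j + 1 / q k) * K_kernel a b \<tau>"
  have K: "K_kernel a b \<tau> = a * b / (2 * \<tau> * (a * \<tau> + b))"
    by (rule K_kernel_eq[OF ab tau])
  have n: "0 < a * \<tau> + b" using ab tau by (simp add: add_pos_pos)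
  have D_eq: "D = 4 * a * b * (cmod z)\<^sup>2 / (\<tau> * (a * \<tau> + b)) * (1 / q j + 1 / q k)"
    by (simp add: D_def K)
  have "has_second_deriv (\<lambda>t. pvm_info a b A B (pvm_of (two_level_rotation e j k \<phi> t))) D 0"
    using pvm_info_two_level_second[OF e jk(1) A B ab(1,2) pj[unfolded p_def q_def]
        pk[unfolded p_def q_def], of \<phi>]
    by (simp only: z D_eq q_def)
  moreover have "0 < D"
  proof -
    have "0 < cmod z" using off by (simp add: z_def \<tau>_def)
    then show ?thesis unfolding D_eq using ab n tau pq
      by (intro mult_pos_pos divide_pos_pos add_pos_pos) auto
  qed
  moreover have "p j / q j = \<tau>" "p k / q k = \<tau>"
    by (simp_all add: \<tau>_def jk(2))
  ultimately show ?thesis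
    using jk(1) D_def[unfolded z_def] by (intro that)
qed

text \<open>The common criterion for local maxima and second-order stationary points; only two-level
  curves are tested.\<close>

lemma globally_optimal_if_no_ascending_rotation:
  fixes e :: "'n::finite \<Rightarrow> complex ^ 'n" and A B :: "'n op" and a b :: real
  assumes "orthonormal_basis e" "pos_def A" "pos_def B" "0 < a" "0 < b" "a + b = 1"
    and "\<And>j k \<phi>. j \<noteq> k \<Longrightarrow>
      ((\<lambda>t. pvm_info a b A B (pvm_of (two_level_rotation e j k \<phi> t))) has_real_derivative 0) (at 0)"
    and "\<And>j k \<phi> D. j \<noteq> k \<Longrightarrow>
      has_second_deriv (\<lambda>t. pvm_info a b A B (pvm_of (two_level_rotation e j k \<phi> t))) D 0 \<Longrightarrow> D \<le> 0"
  shows "globally_optimal a b A B (pvm_of e)"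
proof (rule ccontr)
  assume "\<not> ?thesis"
  then obtain j k \<phi> D where "j \<noteq> k" "0 < D"
    "has_second_deriv (\<lambda>t. pvm_info a b A B (pvm_of (two_level_rotation e j k \<phi> t))) D 0"
    using exists_ascending_rotation[OF assms(1-7)] by metis
  with assms(8) show False by fastforce
qed

lemma critical_two_level:
  assumes "critical F (pvm_of e)" "orthonormal_basis e" "j \<noteq> k"
  shows "((\<lambda>t. F (pvm_of (two_level_rotation e j k \<phi> t))) has_real_derivative 0) (at 0)"
  using assms(1) two_level_generator_tangent[OF assms(2,3)]
  unfolding critical_def by (force simp flip: geodesic_two_level_generator[OF assms(2,3)])

text \<open>The third claim quantifies over bases because \<open>a\<^sub>j\<^sub>k\<close> and the
  rotation depend on the phases of the basis vectors, which the PVM forgets.\<close>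

theorem theorem8p2:
  fixes \<rho>\<^sub>0 \<rho>\<^sub>1 :: "complex ^ 'n::finite ^ 'n" and a b :: real
  assumes "density_operator \<rho>\<^sub>0" and "faithful \<rho>\<^sub>0"
    and "density_operator \<rho>\<^sub>1" and "faithful \<rho>\<^sub>1"
    and "a > 0" and "b > 0" and "a + b = 1"
  shows
    "(\<forall>P. local_maximum (pvm_info a b \<rho>\<^sub>0 \<rho>\<^sub>1) P \<longrightarrow> globally_optimal a b \<rho>\<^sub>0 \<rho>\<^sub>1 P) \<and>
     (\<forall>P. second_order_stationary (pvm_info a b \<rho>\<^sub>0 \<rho>\<^sub>1) P \<longrightarrow> globally_optimal a b \<rho>\<^sub>0 \<rho>\<^sub>1 P) \<and>
     (\<forall>e :: 'n \<Rightarrow> complex ^ 'n.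
        orthonormal_basis e \<and> critical (pvm_info a b \<rho>\<^sub>0 \<rho>\<^sub>1) (pvm_of e) \<and>
        \<not> globally_optimal a b \<rho>\<^sub>0 \<rho>\<^sub>1 (pvm_of e) \<longrightarrow>
        (let p = (\<lambda>i. born \<rho>\<^sub>0 (pvm_of e i));
             q = (\<lambda>i. born \<rho>\<^sub>1 (pvm_of e i));
             r = (\<lambda>i. posterior a b \<rho>\<^sub>0 \<rho>\<^sub>1 (pvm_of e i))
         in \<exists>j k t \<phi>. j \<noteq> k \<and> p j / q j = t \<and> p k / q k = t \<and> r j = r k \<and>
              (let a\<^sub>j\<^sub>k = hinner (e j) ((\<rho>\<^sub>0 - t *\<^sub>R \<rho>\<^sub>1) *v e k);
                   D = 8 * (cmod a\<^sub>j\<^sub>k)\<^sup>2 * (1 / q j + 1 / q k) * K_kernel a b t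
               in has_second_deriv
                    (\<lambda>\<theta>. pvm_info a b \<rho>\<^sub>0 \<rho>\<^sub>1 (pvm_of (two_level_rotation e j k \<phi> \<theta>))) D 0 \<and>
                  D > 0)))"
proof -
  have pd: "pos_def \<rho>\<^sub>0" "pos_def \<rho>\<^sub>1" using assms by (auto simp: faithful_def)
  show ?thesis
  proof (intro conjI allI impI)
    fix P assume max: "local_maximum (pvm_info a b \<rho>\<^sub>0 \<rho>\<^sub>1) P"
    then obtain e where e: "orthonormal_basis e" and P: "P = pvm_of e"
      by (auto simp: local_maximum_def rank_one_pvms_def)
    show "globally_optimal a b \<rho>\<^sub>0 \<rho>\<^sub>1 P"
      unfolding P
    proof (rule globally_optimal_if_no_ascending_rotation[OF e pd assms(5-7)])
      fix j k :: 'n and \<phi> assume jk: "j \<noteq> k"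
      note max' = local_maximum_two_level[OF max[unfolded P] e jk, of \<phi>]
      note d = pvm_info_two_level_first[OF e jk pd assms(5,6), of \<phi>]
      show crit: "((\<lambda>t. pvm_info a b \<rho>\<^sub>0 \<rho>\<^sub>1 (pvm_of (two_level_rotation e j k \<phi> t)))
          has_real_derivative 0) (at 0)"
        using d zero_derivative_if_local_max[OF d max'] by simp
      show "D \<le> 0" if "has_second_deriv
          (\<lambda>t. pvm_info a b \<rho>\<^sub>0 \<rho>\<^sub>1 (pvm_of (two_level_rotation e j k \<phi> t))) D 0" for D
        using not_local_max_if_second_deriv_pos[OF that _ crit] max' by fastforce
    qed
  next
    fix P assume sos: "second_order_stationary (pvm_info a b \<rho>\<^sub>0 \<rho>\<^sub>1) P"
    then obtain e where e: "orthonormal_basis e" and P: "P = pvm_of e"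
      by (auto simp: second_order_stationary_def critical_def rank_one_pvms_def)
    have crit: "critical (pvm_info a b \<rho>\<^sub>0 \<rho>\<^sub>1) (pvm_of e)"
      using sos by (simp add: second_order_stationary_def P)
    show "globally_optimal a b \<rho>\<^sub>0 \<rho>\<^sub>1 P"
      unfolding P
    proof (rule globally_optimal_if_no_ascending_rotation[OF e pd assms(5-7)])
      fix j k :: 'n and \<phi> assume jk: "j \<noteq> k"
      show "((\<lambda>t. pvm_info a b \<rho>\<^sub>0 \<rho>\<^sub>1 (pvm_of (two_level_rotation e j k \<phi> t)))
          has_real_derivative 0) (at 0)"
        by (rule critical_two_level[OF crit e jk])
      \<comment> \<open>The Hessian at the generator is the second derivative along the rotation,
        and its uniqueness transfers the sign to \<open>D\<close>.\<close>
      obtain D' where "D' \<le> 0"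
        "has_hessian (pvm_info a b \<rho>\<^sub>0 \<rho>\<^sub>1) (pvm_of e) (two_level_generator e j k \<phi>) D'"
        using sos two_level_generator_tangent[OF e jk]
        unfolding second_order_stationary_def P by blast
      then show "D \<le> 0" if "has_second_deriv
          (\<lambda>t. pvm_info a b \<rho>\<^sub>0 \<rho>\<^sub>1 (pvm_of (two_level_rotation e j k \<phi> t))) D 0" for D
        using has_second_deriv_unique[OF that]
        unfolding has_hessian_def geodesic_two_level_generator[OF e jk] by metis
    qed
  next
    fix e :: "'n \<Rightarrow> complex ^ 'n"
    assume "orthonormal_basis e \<and> critical (pvm_info a b \<rho>\<^sub>0 \<rho>\<^sub>1) (pvm_of e) \<and>
        \<not> globally_optimal a b \<rho>\<^sub>0 \<rho>\<^sub>1 (pvm_of e)"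
    then have e: "orthonormal_basis e" and crit: "critical (pvm_info a b \<rho>\<^sub>0 \<rho>\<^sub>1) (pvm_of e)"
      and nopt: "\<not> globally_optimal a b \<rho>\<^sub>0 \<rho>\<^sub>1 (pvm_of e)" by auto
    \<comment> \<open>The posterior is a function of the likelihood ratio alone, so equal ratios put
      \<open>j\<close> and \<open>k\<close> in one block.\<close>
    have posterior: "posterior a b \<rho>\<^sub>0 \<rho>\<^sub>1 (pvm_of e i) = a * t / (a * t + b)"
      if "born \<rho>\<^sub>0 (pvm_of e i) / born \<rho>\<^sub>1 (pvm_of e i) = t" for i t
    proof -
      have q: "0 < born \<rho>\<^sub>1 (pvm_of e i)" by (rule born_pvm_of_pos[OF pd(2) e])
      then have "born \<rho>\<^sub>0 (pvm_of e i) = t * born \<rho>\<^sub>1 (pvm_of e i)" using that by auto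
      moreover have "a * (t * x) / (a * (t * x) + b * x) = a * t / (a * t + b)" if "0 < x" for x
      proof -
        have "a * (t * x) / (a * (t * x) + b * x) = (a * t * x) / ((a * t + b) * x)"
          by (simp add: algebra_simps)
        then show ?thesis using that by simp
      qed
      ultimately show ?thesis using q by (simp add: posterior_def)
    qed
    obtain j k t \<phi> D where "j \<noteq> k"
      "born \<rho>\<^sub>0 (pvm_of e j) / born \<rho>\<^sub>1 (pvm_of e j) = t"
      "born \<rho>\<^sub>0 (pvm_of e k) / born \<rho>\<^sub>1 (pvm_of e k) = t"
      "D = 8 * (cmod (hinner (e j) ((\<rho>\<^sub>0 - t *\<^sub>R \<rho>\<^sub>1) *v e k)))\<^sup>2 *
        (1 / born \<rho>\<^sub>1 (pvm_of e j) + 1 / born \<rho>\<^sub>1 (pvm_of e k)) * K_kernel a b t"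
      "has_second_deriv (\<lambda>\<theta>. pvm_info a b \<rho>\<^sub>0 \<rho>\<^sub>1 (pvm_of (two_level_rotation e j k \<phi> \<theta>))) D 0"
      "0 < D"
      by (rule exists_ascending_rotation[OF e pd assms(5-7) critical_two_level[OF crit e] nopt])
    then show "let p = (\<lambda>i. born \<rho>\<^sub>0 (pvm_of e i));
             q = (\<lambda>i. born \<rho>\<^sub>1 (pvm_of e i));
             r = (\<lambda>i. posterior a b \<rho>\<^sub>0 \<rho>\<^sub>1 (pvm_of e i))
         in \<exists>j k t \<phi>. j \<noteq> k \<and> p j / q j = t \<and> p k / q k = t \<and> r j = r k \<and>
              (let a\<^sub>j\<^sub>k = hinner (e j) ((\<rho>\<^sub>0 - t *\<^sub>R \<rho>\<^sub>1) *v e k);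
                   D = 8 * (cmod a\<^sub>j\<^sub>k)\<^sup>2 * (1 / q j + 1 / q k) * K_kernel a b t
               in has_second_deriv
                    (\<lambda>\<theta>. pvm_info a b \<rho>\<^sub>0 \<rho>\<^sub>1 (pvm_of (two_level_rotation e j k \<phi> \<theta>))) D 0 \<and>
                  D > 0)"
      unfolding Let_def using posterior by metis
  qed
qed

end
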